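(* Let $T$ be an interval exchange map of $d\ge 2$ intervals on $I=[0,1)$ with admissible combinatorial data and the Keane property. Suppose that for every $\varepsilon>0$ there is $C_\varepsilon>0$ such that $\Delta(T^n)\ge C_\varepsilon\,n^{-(1+\varepsilon)}$ for all $n\ge1$ (Condition (D)). Then $$\lim_{r\to0^+}\frac{\log\tau_r(x)}{-\log r}=1\quad\text{uniformly in }x\in I$$ (Condition (U)).
   Context: Interval exchange maps. Let $\mathcal A$ be an alphabet with $d\ge2$ letters. Combinatorial data is a pair $\pi=(\pi_t,\pi_b)$ of bijections $\mathcal A\to\{1,\dots,d\}$; it is admissible if $\pi_t^{-1}(\{1,\dots,k\})\ne\pi_b^{-1}(\{1,\dots,k\})$ for $k=1,\dots,d-1$. Length data is a vector $(\lambda_\alpha)_{\alpha\in\mathcal A}$ of positive reals, here with $\lambda^*=\sum_\alpha\lambda_\alpha=1$; $I=[0,\lambda^* )$, $p_\alpha=\sum_{\pi_t(\beta)<\pi_t(\alpha)}\lambda_\beta$, $I_\alpha=[p_\alpha,p_\alpha+\lambda_\alpha)$. The map is $T(x)=x+\sum_{\pi_b(\beta)<\pi_b(\alpha)}\lambda_\beta-\sum_{\pi_t(\beta)<\pi_t(\alpha)}\lambda_\beta$ for $x\in I_\alpha$. Keane property: there are no $\alpha,\beta\in\mathcal A$ and $m\ge1$ with $T^m(p_\alpha)=p_\beta$ and $\pi_t(\beta)>1$. Discontinuities. $D(T)=\{p_\alpha:\pi_t(\alpha)>1\}$, $D(T^n)=\bigcup_{i=0}^{n-1}T^{-i}(D(T))$,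 and $\Delta(T^n)$ is the minimum distance between distinct points of $D(T^n)\cup\{0,1\}$. Return time. $\tau_r(x)=\min\{j\ge1:\ |T^jx-x|<r\}$ for $r>0$, $x\in I$. *)

theory Defs
  imports "HOL-Analysis.Analysis"
begin

text \<open>
  The alphabet is a finite type \<open>'a\<close>, so \<open>d = CARD('a)\<close>. Combinatorial data is a pair of
  functions \<open>pt\<close>, \<open>pb\<close> (top and bottom), length data is \<open>lam\<close>. Lengths are normalized, so
  the domain of the map is \<open>{0..<1}\<close>.
\<close>

definition comb_data :: "('a::finite \<Rightarrow> nat) \<Rightarrow> ('a \<Rightarrow> nat) \<Rightarrow> bool" where
  "comb_data pt pb \<longleftrightarrow>
     bij_betw pt UNIV {1..CARD('a)} \<and> bij_betw pb UNIV {1..CARD('a)}"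

definition admissible :: "('a::finite \<Rightarrow> nat) \<Rightarrow> ('a \<Rightarrow> nat) \<Rightarrow> bool" where
  "admissible pt pb \<longleftrightarrow> (\<forall>k\<in>{1..CARD('a) - 1}. pt -` {1..k} \<noteq> pb -` {1..k})"

definition length_data :: "('a::finite \<Rightarrow> real) \<Rightarrow> bool" where
  "length_data lam \<longleftrightarrow> (\<forall>\<alpha>. lam \<alpha> > 0) \<and> (\<Sum>\<alpha>\<in>UNIV. lam \<alpha>) = 1"

text \<open>The left endpoint of the interval labelled \<open>\<alpha>\<close> when the intervals are ordered by \<open>\<pi>\<close>:
  \<open>left_end pt lam \<alpha>\<close> is $p_\alpha$.\<close>

definition left_end :: "('a::finite \<Rightarrow> nat) \<Rightarrow> ('a \<Rightarrow> real) \<Rightarrow> 'a \<Rightarrow> real" where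
  "left_end \<pi> lam \<alpha> = (\<Sum>\<beta> | \<pi> \<beta> < \<pi> \<alpha>. lam \<beta>)"

definition top_interval :: "('a::finite \<Rightarrow> nat) \<Rightarrow> ('a \<Rightarrow> real) \<Rightarrow> 'a \<Rightarrow> real set" where
  "top_interval pt lam \<alpha> = {left_end pt lam \<alpha> ..< left_end pt lam \<alpha> + lam \<alpha>}"

text \<open>The top intervals are pairwise disjoint, so the sum has at most one term: it is the
  translation on the interval containing \<open>x\<close> (see \<open>iem_eq\<close> below), and outside
  \<open>{0..<1}\<close> the map is the identity.\<close>

definition iem :: "('a::finite \<Rightarrow> nat) \<Rightarrow> ('a \<Rightarrow> nat) \<Rightarrow> ('a \<Rightarrow> real) \<Rightarrow> real \<Rightarrow> real" where
  "iem pt pb lam x =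
     x + (\<Sum>\<alpha> | x \<in> top_interval pt lam \<alpha>. left_end pb lam \<alpha> - left_end pt lam \<alpha>)"

lemma left_end_step:
  assumes "length_data lam" "pt \<alpha> < pt \<beta>"
  shows "left_end pt lam \<alpha> + lam \<alpha> \<le> left_end pt lam \<beta>"
proof -
  have "left_end pt lam \<alpha> + lam \<alpha> = (\<Sum>\<gamma>\<in>insert \<alpha> {\<gamma>. pt \<gamma> < pt \<alpha>}. lam \<gamma>)"
    by (simp add: left_end_def)
  also have "\<dots> \<le> (\<Sum>\<gamma> | pt \<gamma> < pt \<beta>. lam \<gamma>)"
    using assms by (intro sum_mono2) (auto simp: length_data_def less_imp_le)
  finally show ?thesis by (simp add: left_end_def)
qed

lemma iem_eq:
  assumes "comb_data pt pb" "length_data lam" "x \<in> top_interval pt lam \<alpha>"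
  shows "iem pt pb lam x =
    x + (\<Sum>\<beta> | pb \<beta> < pb \<alpha>. lam \<beta>) - (\<Sum>\<beta> | pt \<beta> < pt \<alpha>. lam \<beta>)"
proof -
  have "\<beta> = \<alpha>" if "x \<in> top_interval pt lam \<beta>" for \<beta>
  proof (rule ccontr)
    assume "\<beta> \<noteq> \<alpha>"
    moreover have "inj pt"
      using assms(1) by (simp add: comb_data_def bij_betw_def)
    ultimately have "pt \<beta> \<noteq> pt \<alpha>"
      by (simp add: inj_eq)
    then consider "pt \<beta> < pt \<alpha>" | "pt \<alpha> < pt \<beta>"
      by linarith
    then show False
    proof cases
      case 1
      show False
        using that assms(3) left_end_step[OF assms(2) 1] by (simp add: top_interval_def)
    next
      case 2
      show False
        using that assms(3) left_end_step[OF assms(2) 2] by (simp add: top_interval_def)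
    qed
  qed
  then have "{\<beta>. x \<in> top_interval pt lam \<beta>} = {\<alpha>}"
    using assms(3) by blast
  then show ?thesis
    by (simp add: iem_def left_end_def)
qed

definition keane :: "('a::finite \<Rightarrow> nat) \<Rightarrow> ('a \<Rightarrow> nat) \<Rightarrow> ('a \<Rightarrow> real) \<Rightarrow> bool" where
  "keane pt pb lam \<longleftrightarrow>
     \<not> (\<exists>\<alpha> \<beta> m. m \<ge> 1 \<and> (iem pt pb lam ^^ m) (left_end pt lam \<alpha>) = left_end pt lam \<beta>
                  \<and> pt \<beta> > 1)"

definition discont :: "('a::finite \<Rightarrow> nat) \<Rightarrow> ('a \<Rightarrow> real) \<Rightarrow> real set" where
  "discont pt lam = {left_end pt lam \<alpha> | \<alpha>. pt \<alpha> > 1}"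

definition discont_iter ::
  "('a::finite \<Rightarrow> nat) \<Rightarrow> ('a \<Rightarrow> nat) \<Rightarrow> ('a \<Rightarrow> real) \<Rightarrow> nat \<Rightarrow> real set" where
  "discont_iter pt pb lam n =
     (\<Union>i<n. {x\<in>{0..<1}. (iem pt pb lam ^^ i) x \<in> discont pt lam})"

text \<open>\<open>Delta pt pb lam n\<close> is $\Delta(T^n)$; the set of distances is finite because the map is
  injective.\<close>

definition Delta ::
  "('a::finite \<Rightarrow> nat) \<Rightarrow> ('a \<Rightarrow> nat) \<Rightarrow> ('a \<Rightarrow> real) \<Rightarrow> nat \<Rightarrow> real" where
  "Delta pt pb lam n =
     Min {\<bar>x - y\<bar> | x y. x \<in> discont_iter pt pb lam n \<union> {0, 1} \<and>
                       y \<in> discont_iter pt pb lam n \<union> {0, 1} \<and> x \<noteq> y}"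

text \<open>Under the Keane property the map is minimal, so the set of return times is nonempty for
  every \<open>r > 0\<close> and \<open>x \<in> {0..<1}\<close>.\<close>

definition return_time :: "(real \<Rightarrow> real) \<Rightarrow> real \<Rightarrow> real \<Rightarrow> nat" where
  "return_time T r x = (LEAST j. j \<ge> 1 \<and> \<bar>(T ^^ j) x - x\<bar> < r)"

end

theory Submission
  imports Defs
begin

text \<open>
  If \<open>T\<close> iterated \<open>n\<close> times moves \<open>x\<close> by less than \<open>r\<close>, the discontinuities of the \<open>2 * n\<close>-th iterate
  have two points closer than \<open>r\<close>, so Condition (D) bounds return times from below.

  For the upper bound, let \<open>J\<close> have discontinuities of the \<open>n\<close>-th iterate as endpoints. Its first return
  time takes at most \<open>CARD('a) + 3\<close> values. If some points of \<open>J\<close> do not return up to time \<open>h\<close>, they fill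
  an interval of length at least \<open>Delta (n + h)\<close>, whose images are disjoint until the next value
  \<open>h'\<close>; hence \<open>h' \<le> (n + h) powr (1 + \<epsilon>) / C\<close>. Iterating over the boundedly many values, every
  point of \<open>J\<close> returns within a time \<open>H\<close> of order \<open>n powr (1 + \<epsilon>')\<close>. By the pigeonhole principle, \<open>J\<close> can be
  chosen shorter than \<open>r\<close> with \<open>n\<close> of order \<open>1 / r\<close>. By minimality every orbit meets \<open>J\<close> within time
  \<open>H\<close>, so all continuity intervals of the \<open>(n + H)\<close>-th iterate are shorter than \<open>r\<close>, and the return bound
  applied to the one that contains \<open>x\<close> gives the claim.
\<close>

section \<open>Partition of the unit interval into intervals of given lengths\<close>

lemma left_end_nonneg:
  assumes "length_data lam"
  shows "0 \<le> left_end \<pi> lam \<alpha>"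
  using assms by (simp add: left_end_def length_data_def sum_nonneg less_imp_le)

lemma left_end_le_1:
  assumes "length_data lam"
  shows "left_end \<pi> lam \<alpha> + lam \<alpha> \<le> 1"
proof -
  have "left_end \<pi> lam \<alpha> + lam \<alpha> = (\<Sum>\<gamma>\<in>insert \<alpha> {\<gamma>. \<pi> \<gamma> < \<pi> \<alpha>}. lam \<gamma>)"
    by (simp add: left_end_def)
  also have "\<dots> \<le> (\<Sum>\<gamma>\<in>UNIV. lam \<gamma>)"
    using assms by (intro sum_mono2) (auto simp: length_data_def less_imp_le)
  finally show ?thesis
    using assms by (simp add: length_data_def)
qed

text \<open>The interval is the last one in the order of \<open>\<pi>\<close> that starts at or
  before \<open>x\<close>: it ends at 1 or where the next one starts, beyond \<open>x\<close>. A
  general \<open>\<pi>\<close> serves both the top order and, for surjectivity, the bottom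
  order.\<close>

lemma left_end_cover:
  fixes \<pi> :: "'a::finite \<Rightarrow> nat"
  assumes bij: "bij_betw \<pi> UNIV {1..CARD('a)}" and len: "length_data lam" and x: "0 \<le> x" "x < 1"
  obtains \<alpha> where "left_end \<pi> lam \<alpha> \<le> x" "x < left_end \<pi> lam \<alpha> + lam \<alpha>"
proof -
  have inj: "inj \<pi>" and ran: "range \<pi> = {1..CARD('a)}"
    using bij by (auto simp: bij_betw_def)
  define S where "S = {\<alpha>. left_end \<pi> lam \<alpha> \<le> x}"
  have "1 \<in> range \<pi>"
    unfolding ran by (simp add: Suc_leI)
  then obtain \<alpha>0 where "\<pi> \<alpha>0 = 1" by force
  have range_\<pi>: "1 \<le> \<pi> \<gamma> \<and> \<pi> \<gamma> \<le> CARD('a)" for \<gamma>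
    using rangeI[of \<pi> \<gamma>] unfolding ran by simp
  have "{\<gamma>. \<pi> \<gamma> < \<pi> \<alpha>0} = {}"
    using range_\<pi> by (simp add: \<open>\<pi> \<alpha>0 = 1\<close> Suc_le_eq)
  then have "left_end \<pi> lam \<alpha>0 = 0"
    by (simp only: left_end_def sum.empty)
  then have "\<alpha>0 \<in> S"
    using x by (simp add: S_def)
  have "Max (\<pi> ` S) \<in> \<pi> ` S"
    using \<open>\<alpha>0 \<in> S\<close> by (intro Max_in) auto
  then obtain \<alpha> where \<alpha>: "\<alpha> \<in> S" "\<pi> \<alpha> = Max (\<pi> ` S)"
    by auto
  have max: "\<pi> \<beta> \<le> \<pi> \<alpha>" if "\<beta> \<in> S" for \<beta>
    using that \<alpha>(2) by simp
  have sum: "left_end \<pi> lam \<alpha> + lam \<alpha> = (\<Sum>\<gamma>\<in>insert \<alpha> {\<gamma>. \<pi> \<gamma> < \<pi> \<alpha>}. lam \<gamma>)"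
    by (simp add: left_end_def)
  have "x < left_end \<pi> lam \<alpha> + lam \<alpha>"
  proof (cases "\<pi> \<alpha> = CARD('a)")
    case True
    have "\<gamma> = \<alpha> \<or> \<pi> \<gamma> < \<pi> \<alpha>" for \<gamma>
      using range_\<pi>[of \<gamma>] True injD[OF inj, of \<gamma> \<alpha>] by linarith
    then have "insert \<alpha> {\<gamma>. \<pi> \<gamma> < \<pi> \<alpha>} = UNIV"
      by auto
    then show ?thesis
      using sum len x by (simp add: length_data_def)
  next
    case False
    then have "Suc (\<pi> \<alpha>) \<in> range \<pi>"
      unfolding ran using range_\<pi>[of \<alpha>] by simp
    then obtain \<beta> where \<beta>: "\<pi> \<beta> = Suc (\<pi> \<alpha>)" by auto
    have "insert \<alpha> {\<gamma>. \<pi> \<gamma> < \<pi> \<alpha>} = {\<gamma>. \<pi> \<gamma> < \<pi> \<beta>}"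
      using inj \<beta> by (auto simp: less_Suc_eq dest: injD)
    then have "left_end \<pi> lam \<alpha> + lam \<alpha> = left_end \<pi> lam \<beta>"
      using sum by (simp add: left_end_def)
    moreover have "\<beta> \<notin> S"
      using max[of \<beta>] \<beta> by auto
    ultimately show ?thesis
      by (simp add: S_def)
  qed
  with \<alpha>(1) that show ?thesis
    by (simp add: S_def)
qed

section \<open>Counting, and a recursive bound for finite sets of integers\<close>

lemma card_subsingleton:
  assumes "\<And>x y. x \<in> A \<Longrightarrow> y \<in> A \<Longrightarrow> x = y"
  shows "finite A \<and> card A \<le> 1"
proof (cases "A = {}")
  case False
  then obtain x where "A = {x}" using assms by blast
  then show ?thesis by simp
qed simp

text \<open>\<open>V\<close> stands for the values of a return time. As long as some value exceeds
  \<open>h\<close>, the hypothesis supplies a new one of controlled size; each step captures one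
  more value and multiplies the exponent of \<open>n\<close> by \<open>e\<close>, so
  \<open>K\<close> steps exhaust \<open>V\<close>. It matters that \<open>B\<close> depends on
  neither \<open>n\<close> nor \<open>V\<close>.\<close>

lemma chain_bound:
  fixes A e :: real
  assumes A: "0 < A" and e: "1 \<le> e"
  shows "\<exists>B>0. \<forall>n V. 1 \<le> n \<longrightarrow> finite V \<longrightarrow> card V \<le> K \<longrightarrow>
    (\<forall>h. (\<exists>h'\<in>V. h < h') \<longrightarrow> (\<exists>h'\<in>V. h < h' \<and> real h' \<le> A * real (n + h) powr e)) \<longrightarrow>
    (\<forall>h\<in>V. real h \<le> B * real n powr (e ^ K))"
proof -
  define step where "step n V \<longleftrightarrow>
    (\<forall>h. (\<exists>h'\<in>V. h < h') \<longrightarrow> (\<exists>h'\<in>V. h < h' \<and> real h' \<le> A * real (n + h) powr e))" for n V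
  have "\<exists>B>0. \<forall>n V. 1 \<le> n \<longrightarrow> finite V \<longrightarrow> step n V \<longrightarrow>
    (\<exists>H. real H \<le> B * real n powr (e ^ k) \<and> (V \<subseteq> {..H} \<or> k \<le> card (V \<inter> {..H})))" for k
  proof (induction k)
    case 0
    show ?case
      by (auto intro!: exI[of _ "1::real"] exI[of _ "0::nat"])
  next
    case (Suc k)
    then obtain B where B: "B > 0"
      "\<And>n V. 1 \<le> n \<Longrightarrow> finite V \<Longrightarrow> step n V \<Longrightarrow>
        \<exists>H. real H \<le> B * real n powr (e ^ k) \<and> (V \<subseteq> {..H} \<or> k \<le> card (V \<inter> {..H}))"
      by blast
    \<comment> \<open>The first summand serves when \<open>H\<close> already bounds \<open>V\<close>
      and is kept; the second comes from
      \<open>n + H \<le> (1 + B) * n powr (e ^ k)\<close>.\<close>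
    define B' where "B' = B + A * (1 + B) powr e"
    have "\<exists>H. real H \<le> B' * real n powr (e ^ Suc k) \<and> (V \<subseteq> {..H} \<or> Suc k \<le> card (V \<inter> {..H}))"
      if nV: "1 \<le> n" "finite V" "step n V" for n V
    proof -
      obtain H where H: "real H \<le> B * real n powr (e ^ k)" "V \<subseteq> {..H} \<or> k \<le> card (V \<inter> {..H})"
        using B(2)[OF nV] by blast
      have ek: "1 \<le> e ^ k" using e by simp
      have n1: "1 \<le> real n" using nV by simp
      have pos: "0 \<le> A * (1 + B) powr e" "0 \<le> B * real n powr (e ^ Suc k)"
        "0 \<le> A * (1 + B) powr e * real n powr (e ^ Suc k)"
        using A B(1) by auto
      show ?thesis
      proof (cases "V \<subseteq> {..H}")
        case True
        have "e ^ k \<le> e ^ Suc k"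
          using e by (intro power_increasing) auto
        then have "real n powr (e ^ k) \<le> real n powr (e ^ Suc k)"
          using n1 by (intro powr_mono) auto
        then have "B * real n powr (e ^ k) \<le> B * real n powr (e ^ Suc k)"
          using B(1) by simp
        then have "real H \<le> B' * real n powr (e ^ Suc k)"
          unfolding B'_def distrib_right using H(1) pos(3) by linarith
        then show ?thesis using True by blast
      next
        case False
        then have "\<exists>h'\<in>V. H < h'" by force
        then obtain h where h: "h \<in> V" "H < h" "real h \<le> A * real (n + H) powr e"
          using nV(3) unfolding step_def by blast
        have "real n powr 1 \<le> real n powr (e ^ k)"
          using n1 ek by (intro powr_mono) auto
        then have "real (n + H) \<le> (1 + B) * real n powr (e ^ k)"
          using H(1) n1 by (simp add: distrib_right)
        then have "real (n + H) powr e \<le> ((1 + B) * real n powr (e ^ k)) powr e"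
          using e by (intro powr_mono2) auto
        also have "\<dots> = (1 + B) powr e * real n powr (e ^ Suc k)"
          using B(1) by (simp add: powr_mult powr_powr mult.commute)
        finally have "real h \<le> A * ((1 + B) powr e * real n powr (e ^ Suc k))"
          using h(3) A by (meson mult_left_mono less_imp_le order.trans)
        then have "real h \<le> B' * real n powr (e ^ Suc k)"
          unfolding B'_def distrib_right mult.assoc using pos(2) by linarith
        moreover have "Suc k \<le> card (V \<inter> {..h})"
        proof -
          have "Suc k \<le> card (insert h (V \<inter> {..H}))"
            using H(2) False h nV(2) by (simp add: card_insert_if)
          also have "\<dots> \<le> card (V \<inter> {..h})"
            using h nV(2) by (intro card_mono) auto
          finally show ?thesis .
        qed
        ultimately show ?thesis by blast
      qed
    qed
    moreover have "B' > 0"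
      using A B(1) by (simp add: B'_def add_pos_nonneg)
    ultimately show ?case by blast
  qed
  from this[of K] obtain B where B: "B > 0"
    "\<And>n V. 1 \<le> n \<Longrightarrow> finite V \<Longrightarrow> step n V \<Longrightarrow>
        \<exists>H. real H \<le> B * real n powr (e ^ K) \<and> (V \<subseteq> {..H} \<or> K \<le> card (V \<inter> {..H}))"
    by blast
  have "real h \<le> B * real n powr (e ^ K)"
    if nV: "1 \<le> n" "finite V" "step n V" and K: "card V \<le> K" and h: "h \<in> V" for n V h
  proof -
    obtain H where H: "real H \<le> B * real n powr (e ^ K)" "V \<subseteq> {..H} \<or> K \<le> card (V \<inter> {..H})"
      using B(2)[OF nV] by blast
    have "V \<inter> {..H} = V" if "K \<le> card (V \<inter> {..H})"
      using that K nV(2) by (intro card_seteq) auto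
    then have "V \<subseteq> {..H}"
      using H(2) by blast
    then show ?thesis
      using H(1) h by (meson atMost_iff of_nat_le_iff order.trans subsetD)
  qed
  then show ?thesis
    using B(1) unfolding step_def by blast
qed

subsection \<open>Discontinuities of the iterates\<close>

locale keane_iet =
  fixes pt pb :: "'a::finite \<Rightarrow> nat" and lam :: "'a \<Rightarrow> real"
  assumes card_ge_2: "CARD('a) \<ge> 2"
    and comb: "comb_data pt pb" and adm: "admissible pt pb"
    and len: "length_data lam" and keane: "keane pt pb lam"
begin

abbreviation T :: "real \<Rightarrow> real" where "T \<equiv> iem pt pb lam"
abbreviation D :: "real set" where "D \<equiv> discont pt lam"

lemma lam_pos: "0 < lam \<alpha>"
  using len by (simp add: length_data_def)

lemma inj_pt: "inj pt" and inj_pb: "inj pb"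
  and range_pt: "range pt = {1..CARD('a)}" and range_pb: "range pb = {1..CARD('a)}"
  using comb by (auto simp: comb_data_def bij_betw_def)

lemma pt_ge_1: "1 \<le> pt \<alpha>" and pb_ge_1: "1 \<le> pb \<alpha>"
  using rangeI[of pt \<alpha>] rangeI[of pb \<alpha>] unfolding range_pt range_pb by simp_all

lemma left_end_first:
  assumes "\<pi> \<alpha> = 1" "\<And>\<gamma>. 1 \<le> \<pi> \<gamma>"
  shows "left_end \<pi> lam \<alpha> = 0"
proof -
  have "{\<gamma>. \<pi> \<gamma> < \<pi> \<alpha>} = {}"
    using assms by (simp add: Suc_le_eq)
  then show ?thesis
    by (simp only: left_end_def sum.empty)
qed

lemma T_eq:
  assumes "left_end pt lam \<alpha> \<le> x" "x < left_end pt lam \<alpha> + lam \<alpha>"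
  shows "T x = x + (left_end pb lam \<alpha> - left_end pt lam \<alpha>)"
  using iem_eq[OF comb len, of x \<alpha>] assms by (simp add: top_interval_def left_end_def)

section \<open>Bijectivity of the map and its iterates\<close>

lemma T_in:
  assumes "x \<in> {0..<1}"
  shows "T x \<in> {0..<1}"
proof -
  obtain \<alpha> where \<alpha>: "left_end pt lam \<alpha> \<le> x" "x < left_end pt lam \<alpha> + lam \<alpha>"
    using left_end_cover[of pt lam x] comb len assms by (auto simp: comb_data_def)
  show ?thesis
    using T_eq[OF \<alpha>] \<alpha> left_end_nonneg[OF len, of pb \<alpha>] left_end_le_1[OF len, of pb \<alpha>]
    by auto
qed

lemma T_inj: "inj_on T {0..<1}"
proof (rule inj_onI)
  fix x y assume xy: "x \<in> {0..<1}" "y \<in> {0..<1}" "T x = T y"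
  obtain \<alpha> where \<alpha>: "left_end pt lam \<alpha> \<le> x" "x < left_end pt lam \<alpha> + lam \<alpha>"
    using left_end_cover[of pt lam x] comb len xy by (auto simp: comb_data_def)
  obtain \<beta> where \<beta>: "left_end pt lam \<beta> \<le> y" "y < left_end pt lam \<beta> + lam \<beta>"
    using left_end_cover[of pt lam y] comb len xy by (auto simp: comb_data_def)
  have "\<not> pb \<alpha> < pb \<beta>" "\<not> pb \<beta> < pb \<alpha>"
    using left_end_step[OF len, of pb \<alpha> \<beta>] left_end_step[OF len, of pb \<beta> \<alpha>]
      T_eq[OF \<alpha>] T_eq[OF \<beta>] xy(3) \<alpha> \<beta> by auto
  then have eq: "\<alpha> = \<beta>"
    using inj_pb by (simp add: inj_eq)
  show "x = y"
    using T_eq[OF \<alpha>] T_eq[OF \<beta>] xy(3) unfolding eq by linarith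
qed

lemma T_surj:
  assumes "y \<in> {0..<1}"
  obtains x where "x \<in> {0..<1}" "T x = y"
proof -
  obtain \<alpha> where \<alpha>: "left_end pb lam \<alpha> \<le> y" "y < left_end pb lam \<alpha> + lam \<alpha>"
    using left_end_cover[of pb lam y] comb len assms by (auto simp: comb_data_def)
  define x where "x = y - left_end pb lam \<alpha> + left_end pt lam \<alpha>"
  have x: "left_end pt lam \<alpha> \<le> x" "x < left_end pt lam \<alpha> + lam \<alpha>"
    using \<alpha> by (auto simp: x_def)
  show ?thesis
  proof (rule that)
    show "x \<in> {0..<1}"
      using x left_end_nonneg[OF len, of pt \<alpha>] left_end_le_1[OF len, of pt \<alpha>] by auto
    show "T x = y"
      using T_eq[OF x] by (simp add: x_def)
  qed
qed

lemma iter_in: "x \<in> {0..<1} \<Longrightarrow> (T ^^ i) x \<in> {0..<1}"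
  by (induction i) (use T_in in auto)

lemma iter_inj: "x \<in> {0..<1} \<Longrightarrow> y \<in> {0..<1} \<Longrightarrow> (T ^^ i) x = (T ^^ i) y \<Longrightarrow> x = y"
proof (induction i)
  case (Suc i)
  then show ?case
    using inj_onD[OF T_inj, of "(T ^^ i) x" "(T ^^ i) y"] iter_in by simp
qed simp

lemma iter_surj:
  assumes "y \<in> {0..<1}"
  obtains x where "x \<in> {0..<1}" "(T ^^ i) x = y"
  using assms
proof (induction i arbitrary: y thesis)
  case (Suc i)
  obtain z where z: "z \<in> {0..<1}" "T z = y"
    using T_surj[OF Suc.prems(2)] by blast
  then show ?case
    using Suc.IH[of z] Suc.prems(1) by (metis comp_apply funpow.simps(2))
qed simp

lemma iter_add: "(T ^^ (m + n)) x = (T ^^ m) ((T ^^ n) x)"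
  by (simp add: funpow_add)

lemma iter_cancel:
  assumes "(T ^^ k) x = (T ^^ l) y" "k \<le> l" "x \<in> {0..<1}" "y \<in> {0..<1}"
  shows "x = (T ^^ (l - k)) y"
  using iter_inj[of x "(T ^^ (l - k)) y" k] assms iter_in iter_add[of k "l - k" y] by simp

section \<open>Discontinuities under the Keane property\<close>

lemma D_subset: "D \<subseteq> {0<..<1}"
proof
  fix x assume "x \<in> D"
  then obtain \<alpha> where \<alpha>: "x = left_end pt lam \<alpha>" "pt \<alpha> > 1"
    by (auto simp: discont_def)
  have "1 \<in> range pt"
    unfolding range_pt by (simp add: Suc_leI)
  then obtain \<beta> where "pt \<beta> = 1" by force
  then have "0 < x"
    using left_end_step[OF len, of pt \<beta> \<alpha>] left_end_nonneg[OF len, of pt \<beta>] lam_pos[of \<beta>] \<alpha> by simp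
  then show "x \<in> {0<..<1}"
    using left_end_le_1[OF len, of pt \<alpha>] lam_pos[of \<alpha>] \<alpha> by simp
qed

lemma finite_D: "finite D" and card_D: "card D \<le> CARD('a)"
proof -
  have "D = left_end pt lam ` {\<alpha>. pt \<alpha> > 1}"
    by (auto simp: discont_def)
  then show "finite D" "card D \<le> CARD('a)"
    by (auto intro!: order.trans[OF card_image_le] card_mono)
qed

lemma D_nonempty: "D \<noteq> {}"
proof -
  have "2 \<in> range pt"
    unfolding range_pt using card_ge_2 by simp
  then obtain \<alpha> where "pt \<alpha> = 2" by force
  then show ?thesis
    by (auto simp: discont_def intro!: exI[of _ \<alpha>])
qed

lemma no_connection:
  assumes "m \<ge> 1"
  shows "(T ^^ m) (left_end pt lam \<alpha>) \<notin> D"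
  using keane assms by (auto simp: keane_def discont_def)

lemma discontE:
  assumes "x \<in> D"
  obtains \<alpha> where "x = left_end pt lam \<alpha>"
  using assms by (auto simp: discont_def)

text \<open>If the points lay in different top intervals, the left endpoint of the later one would
  be a discontinuity beyond \<open>x\<close> and at most \<open>y\<close>.\<close>

lemma T_translation:
  assumes "x \<in> {0..<1}" "y \<in> {0..<1}" "x \<le> y" and no: "\<And>p. p \<in> D \<Longrightarrow> \<not> (x < p \<and> p \<le> y)"
  shows "T y = y + (T x - x)"
proof -
  obtain \<alpha> where \<alpha>: "left_end pt lam \<alpha> \<le> x" "x < left_end pt lam \<alpha> + lam \<alpha>"
    using left_end_cover[of pt lam x] comb len assms by (auto simp: comb_data_def)
  obtain \<beta> where \<beta>: "left_end pt lam \<beta> \<le> y" "y < left_end pt lam \<beta> + lam \<beta>"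
    using left_end_cover[of pt lam y] comb len assms by (auto simp: comb_data_def)
  have "pt \<alpha> = pt \<beta>"
  proof (rule ccontr)
    assume ne: "pt \<alpha> \<noteq> pt \<beta>"
    have "\<not> pt \<beta> < pt \<alpha>"
      using left_end_step[OF len, of pt \<beta> \<alpha>] \<alpha> \<beta> assms by auto
    with ne have *: "pt \<alpha> < pt \<beta>" by simp
    moreover note pt_ge_1[of \<alpha>]
    ultimately have "left_end pt lam \<beta> \<in> D"
      by (auto simp: discont_def)
    then show False
      using no[of "left_end pt lam \<beta>"] left_end_step[OF len, of pt \<alpha> \<beta>] * \<alpha> \<beta> by auto
  qed
  then have "\<alpha> = \<beta>"
    using inj_pt by (simp add: inj_eq)
  then show ?thesis
    using T_eq[OF \<alpha>] T_eq[OF \<beta>] by simp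
qed

section \<open>Cuts and gaps of the iterates\<close>

definition cuts :: "nat \<Rightarrow> real set" where
  "cuts n = discont_iter pt pb lam n \<union> {0, 1}"

lemma discont_iter_iff:
  "x \<in> discont_iter pt pb lam n \<longleftrightarrow> x \<in> {0..<1} \<and> (\<exists>i<n. (T ^^ i) x \<in> D)"
  by (auto simp: discont_iter_def)

lemma cuts_subset: "cuts n \<subseteq> {0..1}"
  by (auto simp: cuts_def discont_iter_def)

lemma cuts_mono: "m \<le> n \<Longrightarrow> cuts m \<subseteq> cuts n"
  by (force simp: cuts_def discont_iter_iff)

lemma cutsI: "x \<in> {0..<1} \<Longrightarrow> i < n \<Longrightarrow> (T ^^ i) x \<in> D \<Longrightarrow> x \<in> cuts n"
  by (auto simp: cuts_def discont_iter_iff)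

lemma cutsE:
  assumes "x \<in> cuts n" "x \<noteq> 0" "x \<noteq> 1"
  obtains i where "i < n" "(T ^^ i) x \<in> D" "x \<in> {0..<1}"
  using assms by (auto simp: cuts_def discont_iter_iff)

text \<open>A cut other than 0 and 1 reaches \<open>D\<close> in fewer than \<open>n\<close> steps.
  The image 0 is excluded because 0 is a cut by convention only.\<close>

lemma cuts_preimage:
  assumes "(T ^^ i) z \<in> cuts n" "(T ^^ i) z \<noteq> 0" "z \<in> {0..<1}"
  shows "z \<in> cuts (n + i)"
proof -
  have "(T ^^ i) z \<noteq> 1"
    using iter_in[OF assms(3), of i] by auto
  then obtain j where "j < n" "(T ^^ j) ((T ^^ i) z) \<in> D"
    using cutsE assms by metis
  then show ?thesis
    using assms(3) by (intro cutsI[of _ "j + i"]) (auto simp: iter_add)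
qed

lemma finite_cuts: "finite (cuts n)"
proof -
  have "finite {x\<in>{0..<1}. (T ^^ i) x \<in> D}" for i
  proof -
    have "inj_on (T ^^ i) {0..<1}"
      using iter_inj by (auto intro: inj_onI)
    then have "finite ((T ^^ i) -` D \<inter> {0..<1})"
      by (intro finite_vimage_IntI finite_D)
    then show ?thesis
      by (rule rev_finite_subset) auto
  qed
  then show ?thesis
    by (simp add: cuts_def discont_iter_def)
qed

lemma Delta_le:
  assumes "x \<in> cuts n" "y \<in> cuts n" "x \<noteq> y"
  shows "Delta pt pb lam n \<le> \<bar>x - y\<bar>"
proof -
  have "{\<bar>x - y\<bar> | x y. x \<in> cuts n \<and> y \<in> cuts n \<and> x \<noteq> y} \<subseteq>
      (\<lambda>(x, y). \<bar>x - y\<bar>) ` (cuts n \<times> cuts n)"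
    by auto
  then have "finite {\<bar>x - y\<bar> | x y. x \<in> cuts n \<and> y \<in> cuts n \<and> x \<noteq> y}"
    by (rule finite_subset) (simp add: finite_cuts)
  then show ?thesis
    unfolding Delta_def cuts_def[symmetric] using assms by (intro Min_le) auto
qed

text \<open>Consecutive cuts: \<open>{a..<b}\<close> is an interval on which each of the first
  \<open>n\<close> iterates is a translation.\<close>

definition gap :: "nat \<Rightarrow> real \<Rightarrow> real \<Rightarrow> bool" where
  "gap n a b \<longleftrightarrow> a \<in> cuts n \<and> b \<in> cuts n \<and> a < b \<and> cuts n \<inter> {a<..<b} = {}"

lemma gap_bounds: "gap n a b \<Longrightarrow> 0 \<le> a \<and> a < b \<and> b \<le> 1"
  using cuts_subset[of n] by (auto simp: gap_def)

lemma gap_exists: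
  assumes "x \<in> {0..<1}"
  obtains a b where "gap n a b" "a \<le> x" "x < b"
proof -
  let ?L = "cuts n \<inter> {..x}" and ?R = "cuts n \<inter> {x<..}"
  have L: "finite ?L" "?L \<noteq> {}" and R: "finite ?R" "?R \<noteq> {}"
    using assms finite_cuts[of n] by (auto simp: cuts_def)
  show ?thesis
  proof (rule that)
    show "gap n (Max ?L) (Min ?R)"
      unfolding gap_def
    proof (intro conjI)
      show "cuts n \<inter> {Max ?L<..<Min ?R} = {}"
      proof (rule ccontr)
        assume "cuts n \<inter> {Max ?L<..<Min ?R} \<noteq> {}"
        then obtain z where z: "z \<in> cuts n" "Max ?L < z" "z < Min ?R" by auto
        show False
          using Max_ge[OF L(1), of z] Min_le[OF R(1), of z] z by (cases "z \<le> x") auto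
      qed
    qed (use Max_in[OF L] Min_in[OF R] in auto)
  qed (use Max_in[OF L] Min_in[OF R] in auto)
qed

text \<open>A discontinuity separating the images at time \<open>i\<close> would pull back, along
  the translation known so far, to a cut inside the gap.\<close>

lemma gap_translation:
  assumes g: "gap n a b"
  shows "i \<le> n \<Longrightarrow> a \<le> z \<Longrightarrow> z < b \<Longrightarrow> (T ^^ i) z = z + ((T ^^ i) a - a)"
proof (induction i arbitrary: z)
  case (Suc i)
  let ?t = "(T ^^ i) a - a"
  have b: "0 \<le> a" "b \<le> 1" using gap_bounds[OF g] by auto
  have z: "(T ^^ i) z = z + ?t"
    using Suc.IH[of z] Suc.prems by linarith
  have "T ((T ^^ i) z) = (T ^^ i) z + (T ((T ^^ i) a) - (T ^^ i) a)"
  proof (rule T_translation)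
    fix p assume p: "p \<in> D"
    show "\<not> ((T ^^ i) a < p \<and> p \<le> (T ^^ i) z)"
    proof
      assume *: "(T ^^ i) a < p \<and> p \<le> (T ^^ i) z"
      then have w: "a < p - ?t" "p - ?t \<le> z"
        using z by auto
      then have "(T ^^ i) (p - ?t) = p"
        using Suc.IH[of "p - ?t"] Suc.prems by linarith
      then have "p - ?t \<in> cuts n"
        using p w Suc.prems b by (intro cutsI[of _ i]) auto
      then show False
        using g w Suc.prems by (auto simp: gap_def)
    qed
  next
    show "(T ^^ i) a \<in> {0..<1}" "(T ^^ i) z \<in> {0..<1}"
      by (rule iter_in; use Suc.prems b in simp)+
    show "(T ^^ i) a \<le> (T ^^ i) z"
      using z Suc.prems by simp
  qed
  then show ?case
    using z by simp
qed simp

text \<open>The endpoint that the translation by \<open>t\<close> moves into the gap, and its preimage, are cuts of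
  \<open>T\<close> iterated \<open>2 * n\<close> times at distance \<open>\<bar>t\<bar>\<close>; the Keane property excludes \<open>t = 0\<close>.\<close>

lemma displacement:
  assumes x: "x \<in> {0..<1}" and n: "n \<ge> 1"
  shows "(T ^^ n) x \<noteq> x" and "Delta pt pb lam (2 * n) \<le> \<bar>(T ^^ n) x - x\<bar>"
proof -
  obtain a b where g: "gap n a b" and ab: "a \<le> x" "x < b"
    using gap_exists[OF x] by blast
  have b: "0 \<le> a" "a < b" "b \<le> 1" and cuts: "a \<in> cuts n" "b \<in> cuts n"
    using gap_bounds[OF g] g by (auto simp: gap_def)
  have cuts2: "a \<in> cuts (2 * n)" "b \<in> cuts (2 * n)"
    using cuts cuts_mono[of n "2 * n"] by auto
  define t where "t = (T ^^ n) a - a"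
  have tr: "(T ^^ n) z = z + t" if "a \<le> z" "z < b" for z
    using gap_translation[OF g, of n z] that by (simp add: t_def)
  have ab_in: "z \<in> {0..<1}" if "a \<le> z" "z < b" for z
    using that b by auto
  have range: "0 \<le> z + t" "z + t < 1" if "a \<le> z" "z < b" for z
    using iter_in[OF ab_in[OF that], of n] tr[OF that] by auto
  have pre: "w - t \<in> cuts (2 * n)" if "w \<in> cuts n" "w \<noteq> 0" "a \<le> w - t" "w - t < b" for w
    using cuts_preimage[of n "w - t" n] tr[of "w - t"] that ab_in[of "w - t"] by (simp add: mult_2)
  have "t \<noteq> 0"
  proof
    assume "t = 0"
    then have Ta: "(T ^^ n) a = a" by (simp add: t_def)
    show False
    \<comment> \<open>If \<open>a > 0\<close>, the periodic orbit of \<open>a\<close> passes through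
      \<open>D\<close>, which is a connection. The cut 0 is no discontinuity and needs another way
      into \<open>D\<close>.\<close>
    proof (cases "a = 0")
      case False
      then obtain i where i: "(T ^^ i) a \<in> D"
        using cutsE[OF cuts(1)] b by auto
      have "(T ^^ n) ((T ^^ i) a) = (T ^^ i) a"
        using Ta iter_add[of n i a] iter_add[of i n a] by (simp add: add.commute)
      then show False
        using i discontE[OF i] no_connection[OF n] by metis
    next
      case True
      \<comment> \<open>0 is the image of the left endpoint whose letter is first at the bottom.
        Admissibility for \<open>k = 1\<close> makes that endpoint a discontinuity, and by
        periodicity the orbit of 0, the first left endpoint at the top, reaches it after
        \<open>n - 1\<close> steps.\<close>
      have "1 \<in> range pb"
        unfolding range_pb by (simp add: Suc_leI)
      then obtain \<beta> where \<beta>: "pb \<beta> = 1" by force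
      then have "left_end pb lam \<beta> = 0"
        using left_end_first pb_ge_1 by blast
      then have T\<beta>: "T (left_end pt lam \<beta>) = 0"
        using T_eq[of \<beta> "left_end pt lam \<beta>"] lam_pos[of \<beta>] by simp
      have "pt \<beta> \<noteq> 1"
      proof
        assume "pt \<beta> = 1"
        have "pt \<gamma> = 1 \<longleftrightarrow> \<gamma> = \<beta>" "pb \<gamma> = 1 \<longleftrightarrow> \<gamma> = \<beta>" for \<gamma>
          using \<beta> \<open>pt \<beta> = 1\<close> injD[OF inj_pt, of \<gamma> \<beta>] injD[OF inj_pb, of \<gamma> \<beta>] by auto
        then have "pt -` {1..1} = pb -` {1..1}"
          by auto
        then show False
          using adm card_ge_2 unfolding admissible_def by (metis One_nat_def Suc_1 atLeastAtMost_iff diff_Suc_1 diff_le_mono le_refl)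
      qed
      then have D: "left_end pt lam \<beta> \<in> D"
        using pt_ge_1[of \<beta>] by (auto simp: discont_def)
      obtain m where m: "n = Suc m"
        using n by (cases n) auto
      have "T ((T ^^ m) 0) = T (left_end pt lam \<beta>)"
        using Ta True T\<beta> m by simp
      then have eq: "(T ^^ m) 0 = left_end pt lam \<beta>"
        using inj_onD[OF T_inj, of "(T ^^ m) 0" "left_end pt lam \<beta>"] D D_subset iter_in[of 0 m] by force
      have "1 \<in> range pt"
        unfolding range_pt by (simp add: Suc_leI)
      then obtain \<alpha> where \<alpha>: "pt \<alpha> = 1" by force
      then have "left_end pt lam \<alpha> = 0"
        using left_end_first pt_ge_1 by blast
      moreover have "m \<noteq> 0"
        using eq D D_subset by (intro notI) auto
      ultimately show False
        using no_connection[of m \<alpha>] eq D by simp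
    qed
  qed
  moreover have "Delta pt pb lam (2 * n) \<le> \<bar>t\<bar>"
  proof (cases "b - a \<le> \<bar>t\<bar>")
    case True
    then show ?thesis
      using Delta_le[OF cuts2] b by simp
  next
    case False
    show ?thesis
    proof (cases "t > 0")
      case True
      then have "b - t \<in> cuts (2 * n)"
        using pre[OF cuts(2)] False b by auto
      then show ?thesis
        using Delta_le[OF cuts2(2), of "b - t"] True by simp
    next
      assume "\<not> t > 0"
      with \<open>t \<noteq> 0\<close> have t: "t < 0" by simp
      \<comment> \<open>\<open>cuts_preimage\<close> excludes the image 0; here
        \<open>a + t\<close>, a point of the orbit, is nonnegative while
        \<open>t < 0\<close>.\<close>
      then have "a \<noteq> 0"
        using range[of a] b by auto
      then have "a - t \<in> cuts (2 * n)"
        using pre[OF cuts(1)] t False b by auto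
      then show ?thesis
        using Delta_le[OF cuts2(1), of "a - t"] t by simp
    qed
  qed
  ultimately show "(T ^^ n) x \<noteq> x" "Delta pt pb lam (2 * n) \<le> \<bar>(T ^^ n) x - x\<bar>"
    using tr[OF ab] by auto
qed

section \<open>Invariance of Lebesgue measure\<close>

lemma measure_image_T:
  assumes "A \<in> lmeasurable" "A \<subseteq> {0..<1}"
  shows "T ` A \<in> lmeasurable \<and> measure lebesgue (T ` A) = measure lebesgue A"
proof -
  \<comment> \<open>On the part of \<open>A\<close> in one top interval the map is a translation.
    Measures add up on both sides since the parts and, by injectivity, their images are
    disjoint.\<close>
  define B where "B \<alpha> = A \<inter> top_interval pt lam \<alpha>" for \<alpha>
  define F where "F \<alpha> = (+) (left_end pb lam \<alpha> - left_end pt lam \<alpha>) ` B \<alpha>" for \<alpha>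
  have B: "B \<alpha> \<in> lmeasurable" for \<alpha>
    unfolding B_def top_interval_def using assms(1) by (intro fmeasurable_Int_fmeasurable) auto
  have F: "F \<alpha> \<in> lmeasurable" "measure lebesgue (F \<alpha>) = measure lebesgue (B \<alpha>)" for \<alpha>
    unfolding F_def by (rule measurable_translation[OF B], rule measure_translation)
  have F_image: "F \<alpha> = T ` B \<alpha>" for \<alpha>
    unfolding F_def by (rule image_cong) (auto simp: B_def top_interval_def T_eq)
  have A: "A = (\<Union>\<alpha>. B \<alpha>)"
  proof -
    have "\<exists>\<alpha>. x \<in> top_interval pt lam \<alpha>" if "x \<in> A" for x
      using left_end_cover[of pt lam x] that assms(2) comb len
      by (force simp: top_interval_def comb_data_def)
    then show ?thesis
      by (auto simp: B_def)
  qed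
  have disj: "disjnt (B \<alpha>) (B \<beta>)" if "\<alpha> \<noteq> \<beta>" for \<alpha> \<beta>
  proof -
    have "pt \<alpha> < pt \<beta> \<or> pt \<beta> < pt \<alpha>"
      using that inj_pt by (metis injD linorder_neqE_nat)
    then show ?thesis
      using left_end_step[OF len, of pt \<alpha> \<beta>] left_end_step[OF len, of pt \<beta> \<alpha>]
      by (fastforce simp: disjnt_def B_def top_interval_def)
  qed
  have disjF: "disjnt (F \<alpha>) (F \<beta>)" if "\<alpha> \<noteq> \<beta>" for \<alpha> \<beta>
  proof -
    have "B \<alpha> \<subseteq> {0..<1}" "B \<beta> \<subseteq> {0..<1}"
      using assms(2) by (auto simp: B_def)
    then show ?thesis
      using disj[OF that] inj_on_image_Int[OF T_inj, of "B \<alpha>" "B \<beta>"]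
      by (simp add: F_image disjnt_def)
  qed
  have "T ` A = (\<Union>\<alpha>. F \<alpha>)"
    unfolding A F_image by auto
  moreover have "(\<Union>\<alpha>. F \<alpha>) \<in> lmeasurable"
    by (rule fmeasurable.finite_UN) (auto intro: F)
  moreover have "measure lebesgue (\<Union>\<alpha>. F \<alpha>) = (\<Sum>\<alpha>\<in>UNIV. measure lebesgue (F \<alpha>))"
    using disjF by (intro measure_UNION') (auto simp: pairwise_def F)
  moreover have "measure lebesgue (\<Union>\<alpha>. B \<alpha>) = (\<Sum>\<alpha>\<in>UNIV. measure lebesgue (B \<alpha>))"
    using disj by (intro measure_UNION') (auto simp: pairwise_def B)
  ultimately show ?thesis
    unfolding A[symmetric] by (simp add: F(2))
qed

lemma measure_image_iter:
  assumes "A \<in> lmeasurable" "A \<subseteq> {0..<1}"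
  shows "(T ^^ k) ` A \<in> lmeasurable \<and> measure lebesgue ((T ^^ k) ` A) = measure lebesgue A"
proof (induction k)
  case (Suc k)
  have "(T ^^ Suc k) ` A = T ` ((T ^^ k) ` A)"
    by (simp add: image_comp)
  moreover have "(T ^^ k) ` A \<subseteq> {0..<1}"
    using assms(2) iter_in by blast
  ultimately show ?case
    using Suc measure_image_T by presburger
qed (use assms in simp)

text \<open>A common point of the \<open>k\<close>-th and \<open>l\<close>-th images with
  \<open>k < l\<close> would give, by injectivity, a return after \<open>l - k < M\<close> steps. So
  \<open>M\<close> disjoint sets of measure \<open>b - a\<close> fit into
  \<open>{0..<1}\<close>.\<close>

lemma nonreturning_bound:
  assumes ab: "0 \<le> a" "a < b" "b \<le> 1"
    and no: "\<And>z k. a \<le> z \<Longrightarrow> z < b \<Longrightarrow> 1 \<le> k \<Longrightarrow> k < M \<Longrightarrow> (T ^^ k) z \<notin> {a..<b}"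
  shows "real M * (b - a) \<le> 1"
proof -
  let ?A = "{a..<b}"
  have A: "?A \<in> lmeasurable" "?A \<subseteq> {0..<1}" "measure lebesgue ?A = b - a"
    using ab by (auto intro!: bounded_set_imp_lmeasurable)
  have aux: "disjnt ((T ^^ k) ` ?A) ((T ^^ l) ` ?A)" if "k < l" "l < M" for k l
  proof (rule ccontr)
    assume "\<not> disjnt ((T ^^ k) ` ?A) ((T ^^ l) ` ?A)"
    then obtain z w where zw: "z \<in> ?A" "w \<in> ?A" "(T ^^ k) z = (T ^^ l) w"
      unfolding disjnt_def by blast
    then have "z = (T ^^ (l - k)) w"
      using iter_cancel[of k z l w] that A(2) by auto
    moreover have "1 \<le> l - k" "l - k < M"
      using that by auto
    ultimately show False
      using no[of w "l - k"] zw by simp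
  qed
  have "disjnt ((T ^^ k) ` ?A) ((T ^^ l) ` ?A)" if "k \<noteq> l" "k < M" "l < M" for k l
    using aux[of k l] aux[of l k] that by (metis disjnt_sym linorder_neqE_nat)
  then have "measure lebesgue (\<Union>k<M. (T ^^ k) ` ?A) = (\<Sum>k<M. measure lebesgue ((T ^^ k) ` ?A))"
    using measure_image_iter[OF A(1,2)] by (intro measure_UNION') (auto simp: pairwise_def)
  also have "\<dots> = real M * (b - a)"
    using measure_image_iter[OF A(1,2)] A(3) by simp
  finally have "real M * (b - a) = measure lebesgue (\<Union>k<M. (T ^^ k) ` ?A)" by simp
  also have "\<dots> \<le> measure lebesgue {0..<1::real}"
  proof (rule measure_mono_fmeasurable)
    show "(\<Union>k<M. (T ^^ k) ` ?A) \<subseteq> {0..<1}"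
      using iter_in A(2) by blast
    have "(\<Union>k<M. (T ^^ k) ` ?A) \<in> lmeasurable"
      by (rule fmeasurable.finite_UN) (use measure_image_iter[OF A(1,2)] in auto)
    then show "(\<Union>k<M. (T ^^ k) ` ?A) \<in> sets lebesgue"
      by (rule fmeasurableD)
  qed (auto intro!: bounded_set_imp_lmeasurable)
  finally show ?thesis by simp
qed

text \<open>Up to time \<open>h\<close> the gap moves rigidly, and no cut of order \<open>n\<close>
  lies inside its image, since it would pull back to a cut of order \<open>n + h\<close> inside the
  gap. Hence the image never straddles \<open>u\<close> or \<open>v\<close>.\<close>

lemma gap_itinerary:
  assumes g: "gap (n + h) a b" and uv: "u \<in> cuts n" "v \<in> cuts n"
    and i: "i \<le> h" and z: "a \<le> z" "z < b" and w: "a \<le> w" "w < b"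
  shows "(T ^^ i) z \<in> {u..<v} \<longleftrightarrow> (T ^^ i) w \<in> {u..<v}"
proof -
  define t where "t = (T ^^ i) a - a"
  have ab: "0 \<le> a" "b \<le> 1" using gap_bounds[OF g] by auto
  have tr: "(T ^^ i) x = x + t" if "a \<le> x" "x < b" for x
    using gap_translation[OF g, of i x] that i by (simp add: t_def)
  have "\<not> (a + t < p \<and> p < b + t)" if p: "p \<in> cuts n" for p
  proof
    assume *: "a + t < p \<and> p < b + t"
    then have x: "(T ^^ i) (p - t) = p" "p - t \<in> {0..<1}"
      using tr[of "p - t"] ab by auto
    have "0 \<le> a + t"
      using iter_in[of a i] tr[of a] ab gap_bounds[OF g] by auto
    then have "p - t \<in> cuts (n + i)"
      using cuts_preimage[of i "p - t" n] x p * by auto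
    then have "p - t \<in> cuts (n + h)"
      using cuts_mono[of "n + i" "n + h"] i by auto
    then show False
      using g * by (auto simp: gap_def)
  qed
  from this[OF uv(1)] this[OF uv(2)] show ?thesis
    using tr[OF z] tr[OF w] z w by auto
qed

subsection \<open>First return times\<close>

definition first_return :: "real set \<Rightarrow> nat \<Rightarrow> real \<Rightarrow> bool" where
  "first_return J h y \<longleftrightarrow> 1 \<le> h \<and> (T ^^ h) y \<in> J \<and> (\<forall>i. 1 \<le> i \<longrightarrow> i < h \<longrightarrow> (T ^^ i) y \<notin> J)"

definition return_values :: "real set \<Rightarrow> nat set" where
  "return_values J = {h. \<exists>y\<in>J. first_return J h y}"

lemma first_return_unique: "first_return J h y \<Longrightarrow> first_return J h' y \<Longrightarrow> h = h'"
  unfolding first_return_def by (metis linorder_neqE_nat)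

lemma first_return_exists:
  assumes "1 \<le> k" "(T ^^ k) y \<in> J"
  obtains h where "first_return J h y" "h \<le> k"
proof -
  define h where "h = (LEAST k. 1 \<le> k \<and> (T ^^ k) y \<in> J)"
  have "1 \<le> h \<and> (T ^^ h) y \<in> J"
    unfolding h_def by (rule LeastI[of _ k]) (use assms in simp)
  moreover have "h \<le> k"
    unfolding h_def by (rule Least_le) (use assms in simp)
  moreover have "(T ^^ i) y \<notin> J" if "1 \<le> i" "i < h" for i
    using not_less_Least[of i "\<lambda>k. 1 \<le> k \<and> (T ^^ k) y \<in> J"] that unfolding h_def by auto
  ultimately show ?thesis
    using that[of h] by (simp add: first_return_def)
qed

text \<open>The first return time to \<open>J = {u..<v}\<close> can only jump at a point of \<open>J\<close> which is the first
  visit to \<open>J\<close> of the backward orbit of a discontinuity or of an endpoint of \<open>J\<close>.\<close>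

definition jump_from :: "real set \<Rightarrow> real \<Rightarrow> real set" where
  "jump_from J p = {c\<in>J. \<exists>j. (T ^^ j) c = p \<and> (\<forall>k. 1 \<le> k \<longrightarrow> k \<le> j \<longrightarrow> (T ^^ k) c \<notin> J)}"

text \<open>Unlike in \<open>jump_from\<close>, time \<open>j\<close> is left out of the window
  because the endpoint \<open>u\<close> itself lies in \<open>J\<close>; requiring
  \<open>j \<ge> 1\<close> keeps the point unique.\<close>

definition jump_from_end :: "real set \<Rightarrow> real \<Rightarrow> real set" where
  "jump_from_end J p =
    {c\<in>J. \<exists>j\<ge>1. (T ^^ j) c = p \<and> (\<forall>k. 1 \<le> k \<longrightarrow> k < j \<longrightarrow> (T ^^ k) c \<notin> J)}"

text \<open>If one point needs more steps to reach \<open>p\<close> than the other, its orbit passes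
  through the other by injectivity: a visit to \<open>J\<close> inside the forbidden window.\<close>

lemma jump_from_unique:
  assumes "J \<subseteq> {0..<1}" "c \<in> jump_from J p" "c' \<in> jump_from J p"
  shows "c = c'"
proof -
  obtain j where j: "(T ^^ j) c = p" "\<And>k. 1 \<le> k \<Longrightarrow> k \<le> j \<Longrightarrow> (T ^^ k) c \<notin> J" "c \<in> J"
    using assms(2) by (auto simp: jump_from_def)
  obtain l where l: "(T ^^ l) c' = p" "\<And>k. 1 \<le> k \<Longrightarrow> k \<le> l \<Longrightarrow> (T ^^ k) c' \<notin> J" "c' \<in> J"
    using assms(3) by (auto simp: jump_from_def)
  have in01: "c \<in> {0..<1}" "c' \<in> {0..<1}"
    using assms(1) j l by auto
  show ?thesis
  proof (cases l j rule: linorder_cases)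
    case less
    then have "c' = (T ^^ (j - l)) c"
      using iter_cancel[of l c' j c] j l in01 by simp
    then show ?thesis
      using j(2)[of "j - l"] less l(3) by simp
  next
    case equal
    then show ?thesis
      using iter_cancel[of l c l c'] j l in01 by simp
  next
    case greater
    then have "c = (T ^^ (l - j)) c'"
      using iter_cancel[of j c l c'] j l in01 by simp
    then show ?thesis
      using l(2)[of "l - j"] greater j(3) by simp
  qed
qed

text \<open>As for \<open>jump_from\<close>; the visit occurs at time \<open>j - l\<close>, which is
  below \<open>j\<close> because \<open>l \<ge> 1\<close>.\<close>

lemma jump_from_end_unique:
  assumes "J \<subseteq> {0..<1}" "c \<in> jump_from_end J p" "c' \<in> jump_from_end J p"
  shows "c = c'"
proof -
  obtain j where j: "1 \<le> j" "(T ^^ j) c = p" "\<And>k. 1 \<le> k \<Longrightarrow> k < j \<Longrightarrow> (T ^^ k) c \<notin> J" "c \<in> J"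
    using assms(2) by (auto simp: jump_from_end_def)
  obtain l where l: "1 \<le> l" "(T ^^ l) c' = p" "\<And>k. 1 \<le> k \<Longrightarrow> k < l \<Longrightarrow> (T ^^ k) c' \<notin> J" "c' \<in> J"
    using assms(3) by (auto simp: jump_from_end_def)
  have in01: "c \<in> {0..<1}" "c' \<in> {0..<1}"
    using assms(1) j l by auto
  show ?thesis
  proof (cases l j rule: linorder_cases)
    case less
    then have "c' = (T ^^ (j - l)) c"
      using iter_cancel[of l c' j c] j l in01 by simp
    then show ?thesis
      using j(3)[of "j - l"] less l(1,4) by simp
  next
    case equal
    then show ?thesis
      using iter_cancel[of l c l c'] j l in01 by simp
  next
    case greater
    then have "c = (T ^^ (l - j)) c'"
      using iter_cancel[of j c l c'] j l in01 by simp
    then show ?thesis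
      using l(3)[of "l - j"] greater j(1,4) by simp
  qed
qed

definition jumps :: "real \<Rightarrow> real \<Rightarrow> real set" where
  "jumps u v = (\<Union>p\<in>D. jump_from {u..<v} p) \<union> jump_from_end {u..<v} u \<union> jump_from_end {u..<v} v"

lemma jumps_card:
  assumes "{u..<v} \<subseteq> {0..<1}"
  shows "finite (jumps u v)" "card (jumps u v) \<le> CARD('a) + 2"
proof -
  have 1: "finite (jump_from {u..<v} p) \<and> card (jump_from {u..<v} p) \<le> 1" for p
    using jump_from_unique[OF assms] by (intro card_subsingleton) blast
  have 2: "finite (jump_from_end {u..<v} p) \<and> card (jump_from_end {u..<v} p) \<le> 1" for p
    using jump_from_end_unique[OF assms] by (intro card_subsingleton) blast
  show "finite (jumps u v)"
    unfolding jumps_def using 1 2 finite_D by auto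
  have "card (\<Union>p\<in>D. jump_from {u..<v} p) \<le> (\<Sum>p\<in>D. card (jump_from {u..<v} p))"
    by (rule card_UN_le[OF finite_D])
  also have "\<dots> \<le> (\<Sum>p\<in>D. 1)"
    using 1 by (intro sum_mono) simp
  finally have "card (\<Union>p\<in>D. jump_from {u..<v} p) \<le> CARD('a)"
    using card_D by simp
  then show "card (jumps u v) \<le> CARD('a) + 2"
    unfolding jumps_def using 2[of u] 2[of v]
    by (intro order.trans[OF card_Un_le] order.trans[OF add_mono[OF card_Un_le order.refl]]) auto
qed

text \<open>The points of \<open>{c..y}\<close> travel in parallel until \<open>c\<close> returns: a
  discontinuity or an endpoint of \<open>{u..<v}\<close> separating them would pull back along the
  common translation to a point of \<open>jumps\<close>. Translation and membership are proved
  together, because membership at earlier times is what makes the pulled back point a jump.\<close>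

lemma orbit_segment:
  assumes J: "{u..<v} \<subseteq> {0..<1}" and cy: "u \<le> c" "c \<le> y" "y < v"
    and nojump: "\<And>s. c < s \<Longrightarrow> s \<le> y \<Longrightarrow> s \<notin> jumps u v"
    and noret: "\<And>k. 1 \<le> k \<Longrightarrow> k < h \<Longrightarrow> (T ^^ k) c \<notin> {u..<v}"
  shows "i \<le> h \<Longrightarrow> c \<le> s \<Longrightarrow> s \<le> y \<Longrightarrow>
    (T ^^ i) s = s + ((T ^^ i) c - c) \<and> (1 \<le> i \<longrightarrow> ((T ^^ i) s \<in> {u..<v} \<longleftrightarrow> (T ^^ i) c \<in> {u..<v}))"
proof (induction i arbitrary: s rule: less_induct)
  case (less i)
  show ?case
  proof (cases i)
    case (Suc m)
    have m: "m < h" using Suc less.prems by simp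
    have inJ: "x \<in> {u..<v}" "x \<in> {0..<1}" if "c \<le> x" "x \<le> s" for x
      using that cy J less.prems by auto
    have off: "(T ^^ k) x \<notin> {u..<v}" if "c \<le> x" "x \<le> s" "1 \<le> k" "k \<le> m" for k x
      using less.IH[of k x] that Suc less.prems noret[of k] m by auto
    let ?t = "(T ^^ m) c - c"
    have trm: "(T ^^ m) x = x + ?t" if "c \<le> x" "x \<le> s" for x
      using less.IH[of m x] that Suc less.prems by auto
    have tr: "(T ^^ i) x = x + ((T ^^ i) c - c)" if x: "c \<le> x" "x \<le> s" for x
    proof -
      have "T ((T ^^ m) x) = (T ^^ m) x + (T ((T ^^ m) c) - (T ^^ m) c)"
      proof (rule T_translation)
        show "(T ^^ m) c \<in> {0..<1}" "(T ^^ m) x \<in> {0..<1}"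
          using iter_in inJ x less.prems by auto
        show "(T ^^ m) c \<le> (T ^^ m) x"
          using trm[OF x] x by simp
        fix p assume p: "p \<in> D"
        show "\<not> ((T ^^ m) c < p \<and> p \<le> (T ^^ m) x)"
        proof
          assume "(T ^^ m) c < p \<and> p \<le> (T ^^ m) x"
          then have w: "c < p - ?t" "p - ?t \<le> x"
            using trm[OF x] by auto
          then have "(T ^^ m) (p - ?t) = p"
            using trm[of "p - ?t"] x by simp
          then have "p - ?t \<in> jump_from {u..<v} p"
            unfolding jump_from_def using off[of "p - ?t"] inJ[of "p - ?t"] w x by auto
          then show False
            using nojump[of "p - ?t"] w x less.prems p by (auto simp: jumps_def)
        qed
      qed
      then show ?thesis
        using trm[OF x] Suc by simp
    qed
    have noend: "\<not> ((T ^^ i) c < p \<and> p \<le> (T ^^ i) s)" if p: "p = u \<or> p = v" for p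
    proof
      let ?r = "(T ^^ i) c - c"
      assume "(T ^^ i) c < p \<and> p \<le> (T ^^ i) s"
      then have w: "c < p - ?r" "p - ?r \<le> s"
        using tr[of s] less.prems by auto
      then have "(T ^^ i) (p - ?r) = p"
        using tr[of "p - ?r"] by simp
      moreover have "(T ^^ k) (p - ?r) \<notin> {u..<v}" if "1 \<le> k" "k < i" for k
        using off[of "p - ?r" k] that w Suc by simp
      ultimately have "p - ?r \<in> jump_from_end {u..<v} p"
        unfolding jump_from_end_def using inJ[of "p - ?r"] w Suc by (auto intro!: exI[of _ i])
      then show False
        using nojump[of "p - ?r"] w less.prems p by (auto simp: jumps_def)
    qed
    have "(T ^^ i) c \<le> (T ^^ i) s"
      using tr[of s] less.prems by simp
    then show ?thesis
      using tr[of s] less.prems noend[of u] noend[of v] by auto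
  qed simp
qed

text \<open>\<open>orbit_segment\<close> requires that \<open>c\<close> does not return before the
  time considered. It is used first up to the first return of \<open>c\<close>, where
  \<open>y\<close> would return as well, so this time is not below \<open>h\<close>; then it is used
  up to \<open>h\<close>.\<close>

lemma first_return_jump:
  assumes J: "{u..<v} \<subseteq> {0..<1}" and cy: "u \<le> c" "c \<le> y" "y < v"
    and nojump: "\<And>s. c < s \<Longrightarrow> s \<le> y \<Longrightarrow> s \<notin> jumps u v"
    and ret: "first_return {u..<v} h y"
  shows "first_return {u..<v} h c"
proof -
  have noret: "(T ^^ k) c \<notin> {u..<v}" if k: "1 \<le> k" "k < h" for k
  proof
    assume "(T ^^ k) c \<in> {u..<v}"
    then obtain l where l: "first_return {u..<v} l c" "l \<le> k"
      using first_return_exists[of k c "{u..<v}"] k by blast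
    then have noret_l: "(T ^^ j) c \<notin> {u..<v}" if "1 \<le> j" "j < l" for j
      using that by (simp add: first_return_def)
    have "(T ^^ l) y \<in> {u..<v}"
      using orbit_segment[where h = l and i = l and s = y, OF J cy nojump noret_l] cy l
      by (simp add: first_return_def)
    then show False
      using ret l k by (auto simp: first_return_def)
  qed
  have h: "1 \<le> h" "(T ^^ h) y \<in> {u..<v}"
    using ret by (simp_all add: first_return_def)
  have "(T ^^ h) c \<in> {u..<v}"
    using orbit_segment[OF J cy nojump noret order.refl cy(2) order.refl] h by blast
  then show ?thesis
    using h(1) noret by (simp add: first_return_def)
qed

text \<open>Moving \<open>y\<close> left to the nearest jump, or to \<open>u\<close> if there is
  none, keeps the first return time. So every value is attained at \<open>u\<close> or at one of at
  most \<open>CARD('a) + 2\<close> jumps.\<close>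

lemma return_values_card:
  assumes J: "{u..<v} \<subseteq> {0..<1}"
  shows "finite (return_values {u..<v})" "card (return_values {u..<v}) \<le> CARD('a) + 3"
proof -
  let ?S = "insert u (jumps u v)"
  define f where "f c = (THE h. first_return {u..<v} h c)" for c
  have f: "f c = h" if "first_return {u..<v} h c" for h c
    unfolding f_def using that first_return_unique by blast
  have "return_values {u..<v} \<subseteq> f ` ?S"
  proof
    fix h assume "h \<in> return_values {u..<v}"
    then obtain y where y: "u \<le> y" "y < v" "first_return {u..<v} h y"
      by (auto simp: return_values_def)
    let ?L = "?S \<inter> {u..y}"
    have L: "finite ?L" "?L \<noteq> {}"
      using jumps_card(1)[OF J] y by auto
    define c where "c = Max ?L"
    have "c \<in> ?L"
      unfolding c_def by (rule Max_in[OF L])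
    then have c: "c \<in> ?S" "u \<le> c" "c \<le> y"
      by auto
    have "s \<notin> jumps u v" if "c < s" "s \<le> y" for s
      using Max_ge[OF L(1), of s] that c by (auto simp: c_def)
    then have "first_return {u..<v} h c"
      using first_return_jump[OF J c(2,3) y(2)] y by blast
    then show "h \<in> f ` ?S"
      using f c(1) by (metis imageI)
  qed
  moreover have fin: "finite ?S"
    using jumps_card(1)[OF J] by simp
  moreover have "card ?S \<le> CARD('a) + 3"
    using jumps_card[OF J] by (simp add: card_insert_if)
  ultimately show "finite (return_values {u..<v})" "card (return_values {u..<v}) \<le> CARD('a) + 3"
    using finite_surj[of ?S] surj_card_le[of ?S] by (blast, meson le_trans)
qed

text \<open>A non-returning gap of \<open>T\<close> iterated \<open>n + h\<close> times sweeps out disjoint images until the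
  next return value \<open>h'\<close>, so Condition (D) bounds \<open>h'\<close> in terms of \<open>h\<close>.\<close>

lemma next_return:
  assumes uv: "u \<in> cuts n" "v \<in> cuts n" and y: "u \<le> y" "y < v"
    and no: "\<And>i. 1 \<le> i \<Longrightarrow> i \<le> h \<Longrightarrow> (T ^^ i) y \<notin> {u..<v}"
  shows "\<exists>h'\<in>return_values {u..<v}. h < h' \<and> real h' * Delta pt pb lam (n + h) \<le> 1"
proof -
  have J: "{u..<v} \<subseteq> {0..<1}"
    using uv cuts_subset[of n] by fastforce
  then have y01: "y \<in> {0..<1}" using y by auto
  obtain a b where g: "gap (n + h) a b" and ab: "a \<le> y" "y < b"
    using gap_exists[OF y01] by blast
  have gb: "0 \<le> a" "a < b" "b \<le> 1" using gap_bounds[OF g] by auto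
  have same: "(T ^^ i) z \<in> {u..<v} \<longleftrightarrow> (T ^^ i) y \<in> {u..<v}" if "i \<le> h" "a \<le> z" "z < b" for i z
    using gap_itinerary[OF g uv that ab] .
  \<comment> \<open>Time 0 of the itinerary: the gap lies inside \<open>{u..<v}\<close>, so avoiding
    \<open>{u..<v}\<close> implies avoiding the gap, as \<open>nonreturning_bound\<close>
    requires.\<close>
  have inJ: "z \<in> {u..<v}" if "a \<le> z" "z < b" for z
    using same[of 0 z] that y by simp
  have nohit: "(T ^^ i) z \<notin> {u..<v}" if "1 \<le> i" "i \<le> h" "a \<le> z" "z < b" for i z
    using same[of i z] that no[of i] by simp
  \<comment> \<open>The least time at which some point of the gap meets \<open>{u..<v}\<close> again
    is a first return time of that point. If there were none, arbitrarily many disjoint images of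
    the gap would fit into the unit interval.\<close>
  let ?R = "\<lambda>k. 1 \<le> k \<and> (\<exists>z. a \<le> z \<and> z < b \<and> (T ^^ k) z \<in> {u..<v})"
  have "\<exists>k. ?R k"
  proof (rule ccontr)
    assume none: "\<nexists>k. ?R k"
    obtain M where M: "real M * (b - a) > 1"
      using reals_Archimedean3[of "b - a"] gb by auto
    have "real M * (b - a) \<le> 1"
      using none inJ by (intro nonreturning_bound[OF gb]) fastforce
    with M show False by simp
  qed
  define h' where "h' = (LEAST k. ?R k)"
  have R: "?R h'"
    unfolding h'_def using \<open>\<exists>k. ?R k\<close> by (rule LeastI_ex)
  have least: "\<not> ?R k" if "k < h'" for k
    using not_less_Least that unfolding h'_def by blast
  obtain z where z: "a \<le> z" "z < b" "(T ^^ h') z \<in> {u..<v}"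
    using R by blast
  have "first_return {u..<v} h' z"
    using R z least by (auto simp: first_return_def)
  then have "h' \<in> return_values {u..<v}"
    using inJ z by (auto simp: return_values_def)
  moreover have "h < h'"
    using nohit[of h' z] z R by (meson linorder_not_le)
  moreover have "real h' * Delta pt pb lam (n + h) \<le> 1"
  proof -
    have "real h' * (b - a) \<le> 1"
      using least inJ by (intro nonreturning_bound[OF gb]) fastforce
    moreover have "Delta pt pb lam (n + h) \<le> b - a"
      using Delta_le[of b "n + h" a] g by (simp add: gap_def)
    ultimately show ?thesis
      by (smt (verit, best) mult_left_mono of_nat_0_le_iff)
  qed
  ultimately show ?thesis by blast
qed

subsection \<open>Minimality\<close>

text \<open>Gaps contain their left endpoints, so even at a cut an iterate is a translation just to
  the right.\<close>

lemma right_translation: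
  assumes "y \<in> {0..<1}"
  shows "\<forall>\<^sub>F s in at_right 0. y + s < 1 \<and> (T ^^ i) (y + s) = (T ^^ i) y + s"
proof -
  obtain a b where g: "gap i a b" and ab: "a \<le> y" "y < b"
    using gap_exists[OF assms] by blast
  have "y + s < 1 \<and> (T ^^ i) (y + s) = (T ^^ i) y + s" if "0 < s" "s < b - y" for s
    using gap_translation[OF g, of i "y + s"] gap_translation[OF g, of i y] ab gap_bounds[OF g] that
    by auto
  then show ?thesis
    using ab by (auto simp: eventually_at_right_field intro!: exI[of _ "b - y"])
qed

text \<open>If \<open>z\<close> had no such preimage, neither would the points just to its right,
  since the complement of \<open>{u..<v}\<close> is open to the right. Orbits starting in
  \<open>{u..<v}\<close> are always at most \<open>H\<close> steps past a visit there, so a short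
  interval starting at \<open>z\<close> would never return to itself, which finite measure
  forbids.\<close>

lemma backward_return:
  assumes J: "{u..<v} \<subseteq> {0..<1}"
    and ret: "\<And>y. y \<in> {u..<v} \<Longrightarrow> \<exists>k. 1 \<le> k \<and> k \<le> H \<and> (T ^^ k) y \<in> {u..<v}"
    and z: "z \<in> {u..<v}"
  shows "\<exists>i w. 1 \<le> i \<and> i \<le> H \<and> w \<in> {u..<v} \<and> (T ^^ i) w = z"
proof (rule ccontr)
  assume "\<not> ?thesis"
  then have none: "(T ^^ i) w \<noteq> z" if "1 \<le> i" "i \<le> H" "w \<in> {u..<v}" for i w
    using that by blast
  have "\<forall>\<^sub>F s in at_right 0. \<forall>w\<in>{u..<v}. (T ^^ i) w \<noteq> z + s" if i: "i \<in> {1..H}" for i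
  proof -
    obtain w where w: "w \<in> {0..<1}" "(T ^^ i) w = z"
      using iter_surj[of z i] z J by blast
    have "w \<notin> {u..<v}"
      using none[of i w] i w by auto
    then have "\<forall>\<^sub>F s in at_right 0. w + s \<notin> {u..<v}"
      by (auto simp: eventually_at_right_field intro!: exI[of _ "if w < u then u - w else 1"])
    moreover have "\<forall>\<^sub>F s::real in at_right 0. 0 < s"
      by (simp add: eventually_at_right_less)
    ultimately show ?thesis
      using right_translation[OF w(1), of i]
    proof eventually_elim
      case (elim s)
      show ?case
      proof (intro ballI notI)
        fix x assume x: "x \<in> {u..<v}" "(T ^^ i) x = z + s"
        then have "x = w + s"
          using iter_inj[of x "w + s" i] elim w J by auto
        then show False
          using x(1) elim by simp
      qed
    qed
  qed
  then have "\<forall>\<^sub>F s in at_right 0. \<forall>i\<in>{1..H}. \<forall>w\<in>{u..<v}. (T ^^ i) w \<noteq> z + s"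
    by (intro eventually_ball_finite) auto
  then obtain \<eta> where \<eta>: "\<eta> > 0" "\<And>s i w. 0 < s \<Longrightarrow> s < \<eta> \<Longrightarrow> i \<in> {1..H} \<Longrightarrow> w \<in> {u..<v} \<Longrightarrow> (T ^^ i) w \<noteq> z + s"
    by (auto simp: eventually_at_right_field)
  define b where "b = min v (z + \<eta>)"
  have "0 \<le> u" "v \<le> 1"
    using z J by (auto simp: atLeastLessThan_subset_iff)
  then have b: "z < b" "b \<le> v" "0 \<le> z" "b \<le> 1"
    using z \<eta>(1) by (auto simp: b_def)
  have recent: "\<exists>i w. 1 \<le> i \<and> i \<le> H \<and> w \<in> {u..<v} \<and> (T ^^ k) x = (T ^^ i) w"
    if "1 \<le> k" "x \<in> {u..<v}" for k x
    using that
  proof (induction k arbitrary: x rule: less_induct)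
    case (less k)
    show ?case
    proof (cases "k \<le> H")
      case True
      with less.prems show ?thesis by blast
    next
      case False
      obtain j where j: "1 \<le> j" "j \<le> H" "(T ^^ j) x \<in> {u..<v}"
        using ret less.prems by blast
      have "(T ^^ k) x = (T ^^ (k - j)) ((T ^^ j) x)"
        using iter_add[of "k - j" j x] False j by simp
      then show ?thesis
        using less.IH[of "k - j" "(T ^^ j) x"] j False by simp
    qed
  qed
  have off: "(T ^^ k) x \<notin> {z..<b}" if x: "z \<le> x" "x < b" and k: "1 \<le> k" for k x
  proof
    assume y: "(T ^^ k) x \<in> {z..<b}"
    have "x \<in> {u..<v}"
      using x b z by auto
    then obtain i w where iw: "1 \<le> i" "i \<le> H" "w \<in> {u..<v}" "(T ^^ k) x = (T ^^ i) w"
      using recent[OF k] by blast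
    show False
    proof (cases "(T ^^ k) x = z")
      case True
      then show False using none iw by metis
    next
      case False
      then show False
        using \<eta>(2)[of "(T ^^ k) x - z" i w] iw y by (auto simp: b_def)
    qed
  qed
  obtain M where "real M * (b - z) > 1"
    using reals_Archimedean3[of "b - z"] b by auto
  moreover have "real M * (b - z) \<le> 1"
    using off by (intro nonreturning_bound) (use b in auto)
  ultimately show False by simp
qed

text \<open>The points whose forward orbit avoids \<open>{u..<v}\<close> form an invariant union of gaps. A boundary
  point of it has only boundary points as preimages until a \<open>T (left_end pt lam \<alpha>)\<close> is reached, and
  all of them are cuts, so that its orbit connects a left endpoint with a discontinuity.\<close>

lemma hitting:
  assumes uv: "u \<in> cuts n" "v \<in> cuts n" "u < v"
    and ret: "\<And>y. y \<in> {u..<v} \<Longrightarrow> \<exists>k. 1 \<le> k \<and> k \<le> H \<and> (T ^^ k) y \<in> {u..<v}"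
    and x: "x \<in> {0..<1}"
  shows "\<exists>k\<le>H. (T ^^ k) x \<in> {u..<v}"
proof -
  have J: "{u..<v} \<subseteq> {0..<1}"
    using uv cuts_subset[of n] by fastforce
  define V where "V = {y\<in>{0..<1}. \<forall>i. (T ^^ i) y \<notin> {u..<v}}"
  \<comment> \<open>\<open>backward_return\<close> finds a visit to \<open>{u..<v}\<close> at most
    \<open>H\<close> steps before the first one. If the first visit came after time
    \<open>H\<close>, the earlier one would lie on the orbit of \<open>y\<close>, contradicting
    minimality.\<close>
  have hit: "\<exists>k\<le>H. (T ^^ k) y \<in> {u..<v}" if y: "y \<in> {0..<1}" "y \<notin> V" for y
  proof -
    define k where "k = (LEAST k. (T ^^ k) y \<in> {u..<v})"
    have "\<exists>k. (T ^^ k) y \<in> {u..<v}"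
      using y unfolding V_def by blast
    then have k: "(T ^^ k) y \<in> {u..<v}"
      unfolding k_def by (rule LeastI_ex)
    have least: "(T ^^ l) y \<notin> {u..<v}" if "l < k" for l
      using not_less_Least that unfolding k_def by blast
    obtain i w where iw: "1 \<le> i" "i \<le> H" "w \<in> {u..<v}" "(T ^^ i) w = (T ^^ k) y"
      using backward_return[OF J ret k] by blast
    have "k \<le> H"
    proof (rule ccontr)
      assume "\<not> k \<le> H"
      then have "w = (T ^^ (k - i)) y"
        using iter_cancel[of i w k y] iw y J by auto
      then show False
        using least[of "k - i"] iw \<open>\<not> k \<le> H\<close> by auto
    qed
    with k show ?thesis by blast
  qed
  \<comment> \<open>Backward invariance rests on \<open>ret\<close>: a point of
    \<open>{u..<v}\<close> comes back at a time \<open>k \<ge> 1\<close>, so its image is not in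
    \<open>V\<close>.\<close>
  have inv: "T y \<in> V \<longleftrightarrow> y \<in> V" if y: "y \<in> {0..<1}" for y
  proof
    assume Ty: "T y \<in> V"
    have off: "(T ^^ Suc i) y \<notin> {u..<v}" for i
      using Ty by (simp add: V_def funpow_swap1)
    have "y \<notin> {u..<v}"
    proof
      assume "y \<in> {u..<v}"
      then obtain k where "1 \<le> k" "(T ^^ k) y \<in> {u..<v}"
        using ret by blast
      then show False
        using off[of "k - 1"] by simp
    qed
    then have "(T ^^ i) y \<notin> {u..<v}" for i
      using off by (cases i) (simp, blast)
    then show "y \<in> V"
      using y by (auto simp: V_def)
  next
    assume "y \<in> V"
    then have "(T ^^ Suc i) y \<notin> {u..<v}" for i
      unfolding V_def by blast
    then show "T y \<in> V"
      using T_in[OF y] by (auto simp: V_def funpow_swap1)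
  qed
  \<comment> \<open>By \<open>hit\<close>, the first \<open>H\<close> steps decide membership in
    \<open>V\<close>, which is therefore constant on gaps of order \<open>n + H\<close>.\<close>
  let ?N = "n + H"
  have V_iff: "y \<in> V \<longleftrightarrow> (\<forall>i\<le>H. (T ^^ i) y \<notin> {u..<v})" if "y \<in> {0..<1}" for y
    using hit[OF that] that by (auto simp: V_def)
  have gapV: "z \<in> V \<longleftrightarrow> w \<in> V" if g: "gap ?N a b" and zw: "a \<le> z" "z < b" "a \<le> w" "w < b" for a b z w
  proof -
    have "z \<in> {0..<1}" "w \<in> {0..<1}"
      using gap_bounds[OF g] zw by auto
    then show ?thesis
      using gap_itinerary[OF g uv(1,2) _ zw] V_iff by blast
  qed
  \<comment> \<open>Boundary points are detected from the left only, since a gap contains its left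
    endpoint and membership is constant on it.\<close>
  define bd where "bd b \<longleftrightarrow> 0 < b \<and> b < 1 \<and> (\<forall>\<eta>>0. \<exists>z. 0 \<le> z \<and> b - \<eta> < z \<and> z < b \<and> (z \<in> V) \<noteq> (b \<in> V))" for b
  have bd_cut: "b \<in> cuts ?N" if b: "bd b" for b
  proof (rule ccontr)
    assume nb: "b \<notin> cuts ?N"
    obtain a c where g: "gap ?N a c" and ac: "a \<le> b" "b < c"
      using gap_exists[of b ?N] b by (auto simp: bd_def)
    have "a < b"
      using g nb ac by (auto simp: gap_def less_le)
    then obtain z where "b - (b - a) < z" "z < b" "(z \<in> V) \<noteq> (b \<in> V)"
      using b unfolding bd_def by (meson diff_gt_0_iff_gt)
    then show False
      using gapV[OF g, of z b] ac by auto
  qed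
  have bd_back: "(\<exists>\<alpha>. b = T (left_end pt lam \<alpha>)) \<or> (\<exists>c. bd c \<and> T c = b)" if b: "bd b" for b
  proof -
    obtain c where c: "c \<in> {0..<1}" "T c = b"
      using T_surj[of b] b by (auto simp: bd_def)
    obtain \<alpha> where \<alpha>: "left_end pt lam \<alpha> \<le> c" "c < left_end pt lam \<alpha> + lam \<alpha>"
      using left_end_cover[of pt lam c] comb len c by (auto simp: comb_data_def)
    show ?thesis
    proof (cases "c = left_end pt lam \<alpha>")
      case True
      then show ?thesis using c by blast
    next
      case False
      let ?p = "left_end pt lam \<alpha>"
      have p: "?p < c" "0 \<le> ?p"
        using False \<alpha> left_end_nonneg[OF len] by auto
      have "\<exists>z. 0 \<le> z \<and> c - \<eta> < z \<and> z < c \<and> (z \<in> V) \<noteq> (c \<in> V)" if "\<eta> > 0" for \<eta>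
      proof -
        \<comment> \<open>The minimum with \<open>c - ?p\<close> keeps \<open>z\<close> in the top
          interval of \<open>c\<close>, where \<open>T\<close> is the same translation.\<close>
        have "min \<eta> (c - ?p) > 0"
          using that p by simp
        then obtain y where y: "b - min \<eta> (c - ?p) < y" "y < b" "(y \<in> V) \<noteq> (b \<in> V)"
          using b unfolding bd_def by meson
        define z where "z = y - (b - c)"
        have z: "?p < z" "c - \<eta> < z" "z < c"
          using y by (auto simp: z_def min_def split: if_splits)
        have "T z = y"
          using T_eq[of \<alpha> z] T_eq[OF \<alpha>] z \<alpha> c(2) by (simp add: z_def)
        then have "(z \<in> V) \<noteq> (c \<in> V)"
          using y(3) inv[OF c(1)] inv[of z] z p c by auto
        then show ?thesis
          using z p by (intro exI[of _ z]) auto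
      qed
      then have "bd c"
        unfolding bd_def using p c by auto
      then show ?thesis using c by blast
    qed
  qed
  have "V = {}"
  proof (rule ccontr)
    assume "V \<noteq> {}"
    then obtain y0 where "y0 \<in> V" by blast
    moreover have "u \<notin> V"
      using uv by (auto simp: V_def intro!: exI[of _ 0])
    moreover have "y0 \<in> {0..<1}" "u \<in> {0..<1}"
      using \<open>y0 \<in> V\<close> J uv by (auto simp: V_def)
    ultimately obtain y where y: "y \<in> {0..<1}" "(y \<in> V) \<noteq> (0 \<in> V)"
      by metis
    \<comment> \<open>The smallest cut whose membership differs from that of 0 is a boundary point,
      because everything below it agrees with 0.\<close>
    define Q where "Q = {q\<in>cuts ?N. 0 \<le> q \<and> q < 1 \<and> (q \<in> V) \<noteq> (0 \<in> V)}"
    obtain a c where g: "gap ?N a c" and ac: "a \<le> y" "y < c"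
      using gap_exists[OF y(1)] by blast
    have "a \<in> Q"
      using gapV[OF g, of a y] ac y g gap_bounds[OF g] by (auto simp: Q_def gap_def)
    have Q: "finite Q" "Q \<noteq> {}"
      using \<open>a \<in> Q\<close> by (auto simp: Q_def finite_cuts)
    define q where "q = Min Q"
    have q: "q \<in> Q"
      unfolding q_def by (rule Min_in[OF Q])
    then have q': "0 < q" "q < 1" "q \<in> cuts ?N" "(q \<in> V) \<noteq> (0 \<in> V)"
      by (auto simp: Q_def less_le)
    have below: "(z \<in> V) = (0 \<in> V)" if z: "0 \<le> z" "z < q" for z
    proof -
      obtain a c where g: "gap ?N a c" and ac: "a \<le> z" "z < c"
        using gap_exists[of z ?N] z q' by auto
      have "a \<notin> Q"
        using Min_le[OF Q(1), of a] ac z by (auto simp: q_def)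
      then have "(a \<in> V) = (0 \<in> V)"
        using g gap_bounds[OF g] ac z q' by (auto simp: Q_def gap_def)
      then show ?thesis
        using gapV[OF g, of a z] ac by auto
    qed
    have "bd q"
      unfolding bd_def
    proof (intro conjI allI impI)
      fix \<eta> :: real assume "\<eta> > 0"
      define z where "z = max 0 (q - \<eta> / 2)"
      have "0 \<le> z" "q - \<eta> < z" "z < q"
        using \<open>\<eta> > 0\<close> q' by (auto simp: z_def max_def)
      then show "\<exists>z. 0 \<le> z \<and> q - \<eta> < z \<and> z < q \<and> (z \<in> V) \<noteq> (q \<in> V)"
        using below q' by blast
    qed (use q' in auto)
    have chain: "(\<exists>\<alpha> k. 1 \<le> k \<and> q = (T ^^ k) (left_end pt lam \<alpha>)) \<or> (\<exists>c. bd c \<and> (T ^^ j) c = q)" for j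
    proof (induction j)
      case 0
      then show ?case using \<open>bd q\<close> by auto
    next
      case (Suc j)
      then show ?case
      proof
        assume "\<exists>c. bd c \<and> (T ^^ j) c = q"
        then obtain c where c: "bd c" "(T ^^ j) c = q" by blast
        from bd_back[OF c(1)] show ?case
        proof
          assume "\<exists>\<alpha>. c = T (left_end pt lam \<alpha>)"
          then obtain \<alpha> where "c = T (left_end pt lam \<alpha>)" by blast
          then have "q = (T ^^ Suc j) (left_end pt lam \<alpha>)"
            using c(2) by (simp add: funpow_swap1)
          then show ?case by (metis le_add1 plus_1_eq_Suc)
        next
          assume "\<exists>d. bd d \<and> T d = c"
          then show ?case
            using c(2) by (auto simp: funpow_swap1)
        qed
      qed blast
    qed
    \<comment> \<open>After \<open>?N\<close> backward steps the boundary point \<open>c\<close> is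
      a cut of order \<open>?N\<close>, so its orbit meets \<open>D\<close> at a time
      \<open>i < ?N\<close>, strictly before it reaches \<open>q\<close>.\<close>
    have "\<exists>\<alpha> k. 1 \<le> k \<and> q = (T ^^ k) (left_end pt lam \<alpha>)"
      using chain[of ?N]
    proof
      assume "\<exists>c. bd c \<and> (T ^^ ?N) c = q"
      then obtain c where c: "bd c" "(T ^^ ?N) c = q" by blast
      then obtain i where i: "i < ?N" "(T ^^ i) c \<in> D"
        using cutsE[OF bd_cut[OF c(1)]] by (auto simp: bd_def)
      obtain \<alpha> where "(T ^^ i) c = left_end pt lam \<alpha>"
        using discontE[OF i(2)] by blast
      then have "q = (T ^^ (?N - i)) (left_end pt lam \<alpha>)"
        using iter_add[of "?N - i" i c] c(2) i(1) by simp
      moreover have "1 \<le> ?N - i" using i(1) by simp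
      ultimately show ?thesis by blast
    qed
    then obtain \<alpha> k where k: "1 \<le> k" "q = (T ^^ k) (left_end pt lam \<alpha>)" by blast
    obtain l where "(T ^^ l) q \<in> D"
      using cutsE[OF q'(3)] q' by auto
    then have "(T ^^ (l + k)) (left_end pt lam \<alpha>) \<in> D"
      using k(2) by (simp add: iter_add)
    then show False
      using no_connection[of "l + k" \<alpha>] k(1) by simp
  qed
  then show ?thesis
    using hit[OF x] by simp
qed

text \<open>By \<open>hitting\<close>, the left end of the gap is in \<open>{u..<v}\<close> at some
  time \<open>k \<le> H\<close>, and then so is the whole translated gap. Two of its points at
  distance \<open>v - u\<close> would not fit.\<close>

lemma gap_length_le:
  assumes uv: "u \<in> cuts n" "v \<in> cuts n" "u < v"
    and ret: "\<And>y. y \<in> {u..<v} \<Longrightarrow> \<exists>k. 1 \<le> k \<and> k \<le> H \<and> (T ^^ k) y \<in> {u..<v}"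
    and g: "gap (n + H) a b"
  shows "b - a \<le> v - u"
proof (rule ccontr)
  assume "\<not> ?thesis"
  then have *: "v - u < b - a" by simp
  have ab: "0 \<le> a" "a < b" "b \<le> 1" using gap_bounds[OF g] by auto
  then obtain k where k: "k \<le> H" "(T ^^ k) a \<in> {u..<v}"
    using hitting[OF uv ret, of a] by auto
  define z where "z = a + (v - u)"
  have z: "a \<le> z" "z < b" using * uv(3) by (auto simp: z_def)
  have "(T ^^ k) z \<in> {u..<v}"
    using gap_itinerary[OF g uv(1,2) k(1) z, of a] k ab by simp
  moreover have "(T ^^ k) z = z + ((T ^^ k) a - a)"
    using gap_translation[OF g _ z, of k] k by simp
  ultimately show False
    using k(2) by (auto simp: z_def)
qed

text \<open>Preimages of one discontinuity under the iterates \<open>0\<close> to \<open>m\<close>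
  give \<open>m + 1\<close> cuts, distinct because the discontinuity is not periodic. Two of them
  share one of the \<open>m\<close> subintervals of length \<open>1 / m\<close>.\<close>

lemma close_cuts:
  assumes m: "m \<ge> 1"
  obtains u v where "u \<in> cuts (m + 1)" "v \<in> cuts (m + 1)" "u < v" "v - u < 1 / real m"
proof -
  obtain p where p: "p \<in> D" using D_nonempty by blast
  then have "p \<in> {0..<1}" using D_subset by force
  then have "\<exists>x. x \<in> {0..<1} \<and> (T ^^ i) x = p" for i
    using iter_surj[of p i] by blast
  then obtain c where c: "\<And>i. c i \<in> {0..<1}" "\<And>i. (T ^^ i) (c i) = p"
    by metis
  have c_ne: "c i \<noteq> c j" if "i < j" for i j
  proof
    assume "c i = c j"
    then have "(T ^^ (j - i)) p = p"
      using iter_add[of "j - i" i "c i"] c(2)[of i] c(2)[of j] that by simp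
    moreover have "p \<in> {0..<1}"
      using p D_subset by force
    ultimately show False
      using displacement(1)[of p "j - i"] that by (simp add: Suc_le_eq)
  qed
  define g where "g i = nat \<lfloor>c i * real m\<rfloor>" for i
  have g: "g i < m" for i
  proof -
    have "c i * real m < real m"
      using c(1)[of i] m by simp
    then have "\<lfloor>c i * real m\<rfloor> < int m"
      by (simp add: floor_less_iff)
    then show ?thesis
      using m unfolding g_def by simp
  qed
  have "\<not> inj_on g {..m}"
    using g by (intro pigeonhole) (metis card_atMost card_lessThan card_mono finite_lessThan image_subsetI le_imp_less_Suc lessThan_iff)
  then obtain i j where ij: "i \<le> m" "j \<le> m" "i < j" "g i = g j"
    unfolding inj_on_def by (metis atMost_iff linorder_neqE_nat)
  have nonneg: "0 \<le> c k * real m" for k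
    using c(1)[of k] by simp
  have "\<lfloor>c i * real m\<rfloor> = \<lfloor>c j * real m\<rfloor>"
    using ij(4) nonneg by (simp add: g_def eq_nat_nat_iff)
  then have "\<bar>c i * real m - c j * real m\<bar> < 1"
    by linarith
  then have "\<bar>c i - c j\<bar> * real m < 1"
    by (simp add: left_diff_distrib[symmetric] abs_mult)
  then have close: "\<bar>c i - c j\<bar> < 1 / real m"
    using m by (simp add: field_simps)
  have cuts: "c k \<in> cuts (m + 1)" if "k \<le> m" for k
    using that c p by (intro cutsI[of _ k]) auto
  show ?thesis
  proof (cases "c i < c j")
    case True
    then show ?thesis
      using that[of "c i" "c j"] cuts ij close by auto
  next
    case False
    then show ?thesis
      using that[of "c j" "c i"] cuts ij close c_ne[OF ij(3)] by auto
  qed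
qed

subsection \<open>Growth of return times\<close>

text \<open>Condition (D) turns \<open>next_return\<close> into the recursion of
  \<open>chain_bound\<close> with \<open>A = 1 / C\<close>, and \<open>return_values_card\<close>
  bounds the number of its steps.\<close>

lemma return_bound:
  assumes C: "C > 0" and e: "1 \<le> e" and D: "\<And>n. 1 \<le> n \<Longrightarrow> Delta pt pb lam n \<ge> C * real n powr (- e)"
  shows "\<exists>B>0. \<forall>n u v y. 1 \<le> n \<longrightarrow> u \<in> cuts n \<longrightarrow> v \<in> cuts n \<longrightarrow> u \<le> y \<longrightarrow> y < v \<longrightarrow>
    (\<exists>k\<ge>1. real k \<le> B * real n powr (e ^ (CARD('a) + 3)) \<and> (T ^^ k) y \<in> {u..<v})"
proof -
  let ?E = "e ^ (CARD('a) + 3)"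
  obtain B where B: "B > 0" "\<And>n V h. 1 \<le> n \<Longrightarrow> finite V \<Longrightarrow> card V \<le> CARD('a) + 3 \<Longrightarrow>
    (\<And>h. (\<exists>h'\<in>V. h < h') \<Longrightarrow> (\<exists>h'\<in>V. h < h' \<and> real h' \<le> 1 / C * real (n + h) powr e)) \<Longrightarrow>
    h \<in> V \<Longrightarrow> real h \<le> B * real n powr ?E"
    using chain_bound[of "1 / C" e "CARD('a) + 3"] C e by (auto 0 4)
  have "\<exists>k\<ge>1. real k \<le> B * real n powr ?E \<and> (T ^^ k) y \<in> {u..<v}"
    if n: "1 \<le> n" and uv: "u \<in> cuts n" "v \<in> cuts n" and y: "u \<le> y" "y < v" for n u v y
  proof -
    let ?V = "return_values {u..<v}"
    have J: "{u..<v} \<subseteq> {0..<1}"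
      using uv cuts_subset[of n] by fastforce
    note V = return_values_card[OF J]
    have "\<exists>h'\<in>?V. h < h' \<and> real h' \<le> 1 / C * real (n + h) powr e" if later: "\<exists>h'\<in>?V. h < h'" for h
    proof -
      obtain l z where l: "h < l" and z: "u \<le> z" "z < v" "first_return {u..<v} l z"
        using later unfolding return_values_def by auto
      have "(T ^^ i) z \<notin> {u..<v}" if "1 \<le> i" "i \<le> h" for i
        using z(3) l that unfolding first_return_def by (meson le_less_trans)
      then obtain h' where h': "h' \<in> ?V" "h < h'" "real h' * Delta pt pb lam (n + h) \<le> 1"
        using next_return[OF uv z(1,2)] by blast
      have "real h' * (C * real (n + h) powr (- e)) \<le> real h' * Delta pt pb lam (n + h)"
        using D[of "n + h"] n by (intro mult_left_mono) auto
      then have "real h' * (C * real (n + h) powr (- e)) \<le> 1"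
        using h'(3) by linarith
      then have "real h' \<le> 1 / C * real (n + h) powr e"
        using C n by (simp add: powr_minus field_simps)
      then show ?thesis using h' by blast
    qed
    then have bound: "real h \<le> B * real n powr ?E" if "h \<in> ?V" for h
      using B(2)[OF n V] that by blast
    \<comment> \<open>If \<open>y\<close> never returned, \<open>next_return\<close> would give a
      return value beyond every \<open>h\<close>, even beyond the largest value.\<close>
    have "\<exists>k\<ge>1. (T ^^ k) y \<in> {u..<v}"
    proof (rule ccontr)
      assume "\<not> ?thesis"
      then have "\<exists>h'\<in>?V. h < h'" for h
        using next_return[OF uv y, of h] by blast
      then have "\<exists>h'\<in>?V. Max ?V < h'" by blast
      then show False
        using Max_ge[OF V(1)] by (meson not_le)
    qed
    then obtain k where k: "first_return {u..<v} k y"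
      using first_return_exists by blast
    then have "k \<in> ?V"
      using y by (auto simp: return_values_def)
    then show ?thesis
      using bound k unfolding first_return_def by blast
  qed
  then show ?thesis
    using B(1) by blast
qed

text \<open>\<open>return_bound\<close> is applied twice: to a cut interval shorter than
  \<open>r\<close>, which makes the gaps of order \<open>n + H\<close> shorter than
  \<open>r\<close>, and to the gap around \<open>x\<close>. Each use contributes the exponent
  \<open>E\<close>, hence \<open>P = E * E\<close>.\<close>

lemma return_time_upper:
  assumes C: "C > 0" and e: "1 \<le> e" and D: "\<And>n. 1 \<le> n \<Longrightarrow> Delta pt pb lam n \<ge> C * real n powr (- e)"
    and P: "P = e ^ (2 * (CARD('a) + 3))"
  shows "\<exists>B>0. \<forall>r x. 0 < r \<longrightarrow> r \<le> 1 \<longrightarrow> x \<in> {0..<1} \<longrightarrow>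
    (\<exists>k\<ge>1. \<bar>(T ^^ k) x - x\<bar> < r \<and> real k \<le> B * r powr (- P))"
proof -
  define E where "E = e ^ (CARD('a) + 3)"
  have "P = E\<^sup>2"
    unfolding P E_def by (metis mult.commute power_mult)
  then have E: "1 \<le> E" "P = E * E"
    using e by (simp_all add: E_def power2_eq_square)
  obtain B where B: "B > 0" "\<And>n u v y. 1 \<le> n \<Longrightarrow> u \<in> cuts n \<Longrightarrow> v \<in> cuts n \<Longrightarrow> u \<le> y \<Longrightarrow> y < v \<Longrightarrow>
    \<exists>k\<ge>1. real k \<le> B * real n powr E \<and> (T ^^ k) y \<in> {u..<v}"
    using return_bound[OF C e D] unfolding E_def by blast
  define B' where "B' = B * ((1 + B) powr E * 3 powr P)"
  have "\<exists>k\<ge>1. \<bar>(T ^^ k) x - x\<bar> < r \<and> real k \<le> B' * r powr (- P)"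
    if r: "0 < r" "r \<le> 1" and x: "x \<in> {0..<1}" for r x
  proof -
    \<comment> \<open>\<open>m\<close> is the least integer with \<open>1 / m \<le> r\<close>. Since
      \<open>r \<le> 1\<close>, \<open>n = m + 1 \<le> 1 / r + 2 \<le> 3 / r\<close>, the source of
      the factor 3 in \<open>B'\<close>.\<close>
    define m where "m = nat \<lceil>1 / r\<rceil>"
    have inv_r: "1 \<le> 1 / r" using r by simp
    have m: "1 / r \<le> real m" "real m \<le> 1 / r + 1"
      unfolding m_def using inv_r by linarith+
    then have m1: "m \<ge> 1" using inv_r by linarith
    define n where "n = m + 1"
    have n: "1 \<le> n" "real n \<le> 3 / r" "1 \<le> real n"
      using m inv_r by (auto simp: n_def)
    obtain u v where uv: "u \<in> cuts n" "v \<in> cuts n" "u < v" "v - u < 1 / real m"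
      using close_cuts[OF m1] unfolding n_def by blast
    have "1 / real m \<le> r"
      using m(1) m1 r by (simp add: field_simps)
    then have "v - u < r"
      using uv by simp
    define H where "H = nat \<lfloor>B * real n powr E\<rfloor>"
    have H: "real H \<le> B * real n powr E"
      unfolding H_def using B(1) by simp
    have ret: "\<exists>k. 1 \<le> k \<and> k \<le> H \<and> (T ^^ k) y \<in> {u..<v}" if y: "y \<in> {u..<v}" for y
    proof -
      obtain k where k: "k \<ge> 1" "real k \<le> B * real n powr E" "(T ^^ k) y \<in> {u..<v}"
        using B(2)[OF n(1) uv(1,2), of y] y by auto
      then have "k \<le> H"
        unfolding H_def by (simp add: le_nat_floor)
      then show ?thesis using k by blast
    qed
    obtain a b where g: "gap (n + H) a b" and ab: "a \<le> x" "x < b"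
      using gap_exists[OF x] by blast
    have "b - a \<le> v - u"
      using gap_length_le[OF uv(1-3) ret g] .
    obtain k where k: "k \<ge> 1" "real k \<le> B * real (n + H) powr E" "(T ^^ k) x \<in> {a..<b}"
      using B(2)[of "n + H" a b x] g ab n(1) by (auto simp: gap_def)
    have "\<bar>(T ^^ k) x - x\<bar> < r"
      using k(3) ab \<open>b - a \<le> v - u\<close> \<open>v - u < r\<close> by auto
    moreover have "real k \<le> B' * r powr (- P)"
    proof -
      have "real n powr 1 \<le> real n powr E"
        using n E by (intro powr_mono) auto
      then have "real (n + H) \<le> (1 + B) * real n powr E"
        using H n by (simp add: distrib_right)
      then have "real (n + H) powr E \<le> ((1 + B) * real n powr E) powr E"
        using E by (intro powr_mono2) auto
      also have "\<dots> = (1 + B) powr E * real n powr P"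
        using B(1) by (simp add: powr_mult powr_powr E)
      also have "\<dots> \<le> (1 + B) powr E * (3 / r) powr P"
        using n E B(1) by (intro mult_left_mono powr_mono2) auto
      also have "\<dots> = (1 + B) powr E * 3 powr P * r powr (- P)"
        using r by (simp add: powr_divide powr_minus field_simps)
      finally have "B * real (n + H) powr E \<le> B * ((1 + B) powr E * 3 powr P * r powr (- P))"
        using B(1) by simp
      then show ?thesis
        using k(2) by (simp add: B'_def mult.assoc)
    qed
    ultimately show ?thesis
      using k(1) by blast
  qed
  moreover have "B' > 0"
    using B(1) by (simp add: B'_def)
  ultimately show ?thesis by blast
qed

text \<open>The upper estimate is the logarithm of \<open>return_time_upper\<close>. For the lower
  one, \<open>displacement\<close> and Condition (D) at \<open>2 * t\<close>, with \<open>t\<close>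
  the return time, give \<open>C * (2 * t) powr (- e) < r\<close>.\<close>

lemma return_time_bounds:
  assumes C: "C > 0" and e: "1 \<le> e" and D: "\<And>n. 1 \<le> n \<Longrightarrow> Delta pt pb lam n \<ge> C * real n powr (- e)"
    and P: "P = e ^ (2 * (CARD('a) + 3))"
  shows "\<exists>c\<ge>0. \<forall>r x. 0 < r \<longrightarrow> r \<le> 1 \<longrightarrow> x \<in> {0..<1} \<longrightarrow>
    ln (real (return_time T r x)) \<le> P * (- ln r) + c \<and> (- ln r) / e - c \<le> ln (real (return_time T r x))"
proof -
  obtain B where B: "B > 0" "\<And>r x. 0 < r \<Longrightarrow> r \<le> 1 \<Longrightarrow> x \<in> {0..<1} \<Longrightarrow>
    \<exists>k\<ge>1. \<bar>(T ^^ k) x - x\<bar> < r \<and> real k \<le> B * r powr (- P)"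
    using return_time_upper[OF C e D P] by blast
  define c where "c = \<bar>ln B\<bar> + \<bar>ln C\<bar> + ln 2"
  have "ln (real (return_time T r x)) \<le> P * (- ln r) + c \<and> (- ln r) / e - c \<le> ln (real (return_time T r x))"
    if r: "0 < r" "r \<le> 1" and x: "x \<in> {0..<1}" for r x
  proof -
    define t where "t = return_time T r x"
    obtain k where k: "k \<ge> 1" "\<bar>(T ^^ k) x - x\<bar> < r" "real k \<le> B * r powr (- P)"
      using B(2)[OF r x] by blast
    have t: "t \<ge> 1 \<and> \<bar>(T ^^ t) x - x\<bar> < r"
      unfolding t_def return_time_def by (rule LeastI[of _ k]) (use k in auto)
    have "t \<le> k"
      unfolding t_def return_time_def by (rule Least_le) (use k in auto)
    then have "real t \<le> B * r powr (- P)"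
      using k(3) by linarith
    then have "ln (real t) \<le> ln (B * r powr (- P))"
      using t by (intro ln_mono) auto
    also have "\<dots> = ln B + P * (- ln r)"
      using B(1) r by (simp add: ln_mult ln_powr)
    also have "\<dots> \<le> P * (- ln r) + c"
      using ln_ge_zero[of 2] unfolding c_def by linarith
    finally have upper: "ln (real t) \<le> P * (- ln r) + c" .
    have "C * real (2 * t) powr (- e) < r"
      using D[of "2 * t"] displacement(2)[OF x, of t] t by simp
    then have "ln (C * real (2 * t) powr (- e)) < ln r"
      using C t r by (subst ln_less_cancel_iff) auto
    then have "ln C - e * ln (2 * real t) < ln r"
      using C t by (simp add: ln_mult ln_powr)
    then have "(- ln r + ln C) / e < ln (2 * real t)"
      using e by (simp add: field_simps)
    moreover have "ln (2 * real t) = ln 2 + ln (real t)"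
      using t by (simp add: ln_mult)
    moreover have "\<bar>ln C / e\<bar> \<le> \<bar>ln C\<bar>"
      using mult_right_mono[OF e, of "\<bar>ln C\<bar>"] e by (simp add: field_simps)
    ultimately have "(- ln r) / e - c \<le> ln (real t)"
      unfolding c_def add_divide_distrib by linarith
    with upper show ?thesis
      by (simp add: t_def)
  qed
  moreover have "c \<ge> 0"
    by (simp add: c_def)
  ultimately show ?thesis by blast
qed

end

section \<open>Passage from logarithmic bounds to the uniform limit\<close>

theorem theorem5p2:
  fixes pt pb :: "'a::finite \<Rightarrow> nat" and lam :: "'a \<Rightarrow> real"
  assumes "CARD('a) \<ge> 2"
    and "comb_data pt pb" and "admissible pt pb"
    and "length_data lam"
    and "keane pt pb lam"
    and condition_D:
      "\<And>\<epsilon>::real. \<epsilon> > 0 \<Longrightarrow>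
         \<exists>C>0. \<forall>n\<ge>1. Delta pt pb lam n \<ge> C * real n powr (- (1 + \<epsilon>))"
  shows "uniform_limit {0..<1}
           (\<lambda>r x. ln (real (return_time (iem pt pb lam) r x)) / (- ln r))
           (\<lambda>x. 1) (at_right 0)"
proof -
  interpret keane_iet pt pb lam
    by (rule keane_iet.intro) (use assms in auto)
  show ?thesis
    unfolding uniform_limit_iff
  proof (intro allI impI)
    fix \<eta> :: real assume \<eta>: "\<eta> > 0"
    define K where "K = 2 * (CARD('a) + 3)"
    \<comment> \<open>Chosen so that the exponent \<open>e ^ K\<close> of the upper bound is
      \<open>1 + \<eta> / 2\<close>; then also \<open>e \<le> 1 + \<eta> / 2\<close>, whence
      \<open>1 / e \<ge> 1 - \<eta> / 2\<close> for the lower bound.\<close>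
    define e where "e = root K (1 + \<eta> / 2)"
    have K: "K > 0" by (simp add: K_def)
    have e: "1 < e" "e ^ K = 1 + \<eta> / 2"
      using K \<eta> by (auto simp: e_def)
    have "e ^ 1 \<le> e ^ K"
      using e K by (intro power_increasing) auto
    then have e_le: "e \<le> 1 + \<eta> / 2"
      using e by simp
    obtain C where C: "C > 0" "\<And>n. 1 \<le> n \<Longrightarrow> Delta pt pb lam n \<ge> C * real n powr (- e)"
      using condition_D[of "e - 1"] e by auto
    obtain c where c: "c \<ge> 0" "\<And>r x. 0 < r \<Longrightarrow> r \<le> 1 \<Longrightarrow> x \<in> {0..<1} \<Longrightarrow>
      ln (real (return_time T r x)) \<le> (1 + \<eta> / 2) * (- ln r) + c \<and>
      (- ln r) / e - c \<le> ln (real (return_time T r x))"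
      using return_time_bounds[OF C(1) less_imp_le[OF e(1)] C(2), of "1 + \<eta> / 2"] e(2)
      unfolding K_def by metis
    have inv_e: "1 - \<eta> / 2 \<le> 1 / e"
    proof -
      have "(1 - \<eta> / 2) * e \<le> 1"
      proof (cases "1 - \<eta> / 2 \<ge> 0")
        case True
        then have "(1 - \<eta> / 2) * e \<le> (1 - \<eta> / 2) * (1 + \<eta> / 2)"
          using e_le by (intro mult_left_mono) auto
        also have "\<dots> \<le> 1"
          by (simp add: algebra_simps)
        finally show ?thesis .
      next
        case False
        then have "(1 - \<eta> / 2) * e \<le> 0"
          using e by (intro mult_nonpos_nonneg) auto
        then show ?thesis by simp
      qed
      then show ?thesis
        using e by (simp add: field_simps)
    qed
    \<comment> \<open>The threshold makes \<open>L = - ln r\<close> exceed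
      \<open>2 * c / \<eta>\<close>, so that \<open>c\<close> costs less than the remaining
      \<open>\<eta> / 2 * L\<close>; the summand 1 gives \<open>L \<ge> 1\<close>.\<close>
    have "dist (ln (real (return_time T r x)) / (- ln r)) 1 < \<eta>"
      if r: "0 < r" "r < exp (- (2 * c / \<eta> + 1))" and x: "x \<in> {0..<1}" for r x
    proof -
      define L where "L = - ln r"
      have "ln r < - (2 * c / \<eta> + 1)"
        using r by (metis exp_gt_zero ln_exp ln_less_cancel_iff)
      then have L: "2 * c / \<eta> < L" "1 \<le> L"
        using c(1) \<eta> by (auto simp: L_def) (smt (verit) divide_nonneg_pos)
      have "r \<le> 1"
        using L(2) r by (simp add: L_def) (smt (verit) ln_ge_zero)
      note bounds = c(2)[OF r(1) this x, folded L_def]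
      have "2 * c < \<eta> * L"
        using L(1) \<eta> by (simp add: field_simps)
      moreover have "(1 - \<eta> / 2) * L \<le> L / e"
        using mult_right_mono[OF inv_e, of L] L(2) by simp
      ultimately have "\<bar>ln (real (return_time T r x)) - L\<bar> < \<eta> * L"
        using bounds by (simp add: algebra_simps abs_less_iff)
      then have "\<bar>ln (real (return_time T r x)) - L\<bar> / L < \<eta>"
        using L(2) by (simp add: pos_divide_less_eq)
      moreover have "ln (real (return_time T r x)) / L - 1 = (ln (real (return_time T r x)) - L) / L"
        using L(2) by (simp add: diff_divide_distrib)
      ultimately show ?thesis
        using L(2) by (simp add: dist_real_def L_def[symmetric] abs_divide)
    qed
    then show "\<forall>\<^sub>F r in at_right 0. \<forall>x\<in>{0..<1}. dist (ln (real (return_time T r x)) / (- ln r)) 1 < \<eta>"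
      unfolding eventually_at_right_field
      by (intro exI[of _ "exp (- (2 * c / \<eta> + 1))"]) auto
  qed
qed

end
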